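(* Let $\Gamma$ be a nonelementary hyperbolic group, let $S\subset\Gamma$ be a finite symmetric set generating $\Gamma$, and let $\lambda\in[-1,1]\mapsto\mu_\lambda\in\mathcal{P}_s(S)$ be a curve such that for every $a\in S$ the function $\lambda\mapsto\log\mu_\lambda(a)$ has a derivative at $\lambda=0$, denoted $\nu(a)$. Let $d\in\mathcal{D}(\Gamma)$ satisfy Assumption (BA). Then the function $\lambda\mapsto\ell(\mu_\lambda;d)$ is differentiable at $\lambda=0$ and $$\frac{d}{d\lambda}\Big|_{\lambda=0}\ell(\mu_\lambda;d)=\sigma(\nu,\mu_0;d).$$
   Context: $\Gamma$ is an infinite, finitely generated (countable, discrete) group with neutral element $\mathrm{id}$. It is hyperbolic (some, equivalently any, word metric is hyperbolic) and nonelementary (i.e. nonamenable; equivalently not a finite extension of $\mathbb{Z}$). For a metric $d$ on $\Gamma$ write $|x-y|=d(x,y)$, $|x|=d(\mathrm{id},x)$, and $(x,y)_w=\frac12(|x-w|+|y-w|-|x-y|)$ (Gromov product). The metric $d$ is hyperbolic if there is a constant $\tau$ with $(x,y)_w\ge\min\{(x,z)_w,(z,y)_w\}-\tau$ for all $x,y,z,w\in\Gamma$ ($d$ need not be geodesic). $\mathcal{D}(\Gamma)$ is the set of left-invariant proper (balls are finite) metrics on $\Gamma$ that are equivalent to a word metric (i.e. quasi-isometric to it via the identity map) and hyperbolic. Gromov compactification: obtained by considering sequences in $\Gamma$ and identifying $(x_n)$ and $(y_n)$ if $(x_n,y_n)_w\to\infty$. Busemann (horo-function) compactification for $d$: identify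 $x\in\Gamma$ with $k_x:\Gamma\to\mathbb{R}$, $k_x(y)=|y-x|-|w-x|$, and take the closure for pointwise convergence. $\Gamma$ acts on both by homeomorphisms. $d$ satisfies Assumption (BA) if these two compactifications coincide up to $\Gamma$-equivariant homeomorphism. A set $S$ is symmetric if $x\in S\Rightarrow x^{-1}\in S$. $\mathcal{P}_s(S)$ is the set of probability measures $\mu$ on $\Gamma$ with support exactly $S$ and $\mu(x^{-1})=\mu(x)$ for all $x$. For a probability measure $\mu$ on $\Gamma$, $\mathbb{P}^\mu$ (expectation $\mathbb{E}^\mu$) is the law of the random walk: $Z_0=\mathrm{id}$ and the increments $X_n=Z_{n-1}^{-1}Z_n$, $n\ge1$, are i.i.d. with law $\mu$. Write $\mathbb{P}^\lambda=\mathbb{P}^{\mu_\lambda}$, $\mathbb{E}^\lambda=\mathbb{E}^{\mu_\lambda}$. The law of $Z_n$ is the $n$th convolution power $\mu^n$. The rate of escape is $\ell(\mu;d)=\lim_{n\to\infty}\frac1n\sum_{x\in\Gamma}d(\mathrm{id},x)\mu^n(x)$. $M_0=0$ and $M_n=\sum_{j=1}^n\nu(X_j)$ for $n\ge1$. One has $\sum_{a\in S}\nu(a)\mu_0(a)=0$. The asymptotic covariance is $\sigma(\nu,\mu_0;d)=\lim_{n\to\infty}\frac1n\mathbb{E}^0[\,|Z_n|\,M_n]$; this limit exists under the present hypotheses. *)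

theory Defs
  imports "HOL-Probability.Probability"
begin

text \<open>
  The group is a type of class \<open>group_add\<close>, which is not assumed commutative. The group law is
  thus written additively: the neutral element is \<open>0\<close>, and \<open>x\<inverse>y\<close> is \<open>- x + y\<close>.
  Metrics on the group are functions \<open>d\<close> of type \<open>'a \<Rightarrow> 'a \<Rightarrow> real\<close>.
\<close>

section \<open>Word metrics, hyperbolicity, amenability\<close>

definition generates :: "'a::group_add set \<Rightarrow> bool" where
  "generates T \<longleftrightarrow> (\<forall>x. \<exists>xs. set xs \<subseteq> T \<union> uminus ` T \<and> sum_list xs = x)"

definition word_length :: "'a::group_add set \<Rightarrow> 'a \<Rightarrow> nat" where
  "word_length T x =
     (LEAST n. \<exists>xs. length xs = n \<and> set xs \<subseteq> T \<union> uminus ` T \<and> sum_list xs = x)"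

definition word_metric :: "'a::group_add set \<Rightarrow> 'a \<Rightarrow> 'a \<Rightarrow> real" where
  "word_metric T x y = real (word_length T (- x + y))"

definition gromov_product :: "('a \<Rightarrow> 'a \<Rightarrow> real) \<Rightarrow> 'a \<Rightarrow> 'a \<Rightarrow> 'a \<Rightarrow> real" where
  "gromov_product d w x y = (d x w + d y w - d x y) / 2"

definition hyperbolic_metric :: "('a \<Rightarrow> 'a \<Rightarrow> real) \<Rightarrow> bool" where
  "hyperbolic_metric d \<longleftrightarrow>
     (\<exists>\<tau>. \<forall>x y z w. gromov_product d w x y
        \<ge> min (gromov_product d w x z) (gromov_product d w z y) - \<tau>)"

definition hyperbolic_group :: "'a::group_add itself \<Rightarrow> bool" where
  "hyperbolic_group _ \<longleftrightarrow>
     (\<exists>T::'a set. finite T \<and> generates T \<and> hyperbolic_metric (word_metric T))"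

definition amenable :: "'a::group_add itself \<Rightarrow> bool" where
  "amenable _ \<longleftrightarrow>
     (\<exists>m :: 'a set \<Rightarrow> real.
        m UNIV = 1 \<and> (\<forall>A. 0 \<le> m A) \<and>
        (\<forall>A B. A \<inter> B = {} \<longrightarrow> m (A \<union> B) = m A + m B) \<and>
        (\<forall>g A. m ((+) g ` A) = m A))"

definition nonelementary :: "'a::group_add itself \<Rightarrow> bool" where
  "nonelementary G \<longleftrightarrow> \<not> amenable G"

definition quasi_isometric_via_id ::
    "('a \<Rightarrow> 'a \<Rightarrow> real) \<Rightarrow> ('a \<Rightarrow> 'a \<Rightarrow> real) \<Rightarrow> bool" where
  "quasi_isometric_via_id d d' \<longleftrightarrow>
     (\<exists>A\<ge>1. \<exists>B\<ge>0. \<forall>x y. d' x y / A - B \<le> d x y \<and> d x y \<le> A * d' x y + B)"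

text \<open>The class \<open>\<D>(\<Gamma>)\<close>.\<close>

definition hyp_metrics :: "('a::group_add \<Rightarrow> 'a \<Rightarrow> real) set" where
  "hyp_metrics =
     {d. Metric_space UNIV d \<and>
         (\<forall>g x y. d (g + x) (g + y) = d x y) \<and>
         (\<forall>x r. finite {y. d x y \<le> r}) \<and>
         (\<exists>T. finite T \<and> generates T \<and> quasi_isometric_via_id d (word_metric T)) \<and>
         hyperbolic_metric d}"

section \<open>Gromov compactification\<close>

definition gromov_sequences :: "('a \<Rightarrow> 'a \<Rightarrow> real) \<Rightarrow> 'a \<Rightarrow> (nat \<Rightarrow> 'a) set" where
  "gromov_sequences d w =
     {s. filterlim (\<lambda>(m, n). gromov_product d w (s m) (s n)) at_top
           (sequentially \<times>\<^sub>F sequentially)}"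

definition gromov_rel :: "('a \<Rightarrow> 'a \<Rightarrow> real) \<Rightarrow> 'a \<Rightarrow> ((nat \<Rightarrow> 'a) \<times> (nat \<Rightarrow> 'a)) set" where
  "gromov_rel d w =
     {(s, t). s \<in> gromov_sequences d w \<and> t \<in> gromov_sequences d w \<and>
        filterlim (\<lambda>n. gromov_product d w (s n) (t n)) at_top sequentially}"

definition gromov_boundary :: "('a \<Rightarrow> 'a \<Rightarrow> real) \<Rightarrow> 'a \<Rightarrow> (nat \<Rightarrow> 'a) set set" where
  "gromov_boundary d w = gromov_sequences d w // gromov_rel d w"

text \<open>Points of the compactification: \<open>Inl x\<close> for group elements, \<open>Inr \<xi>\<close> for boundary points.\<close>

definition gromov_points :: "('a \<Rightarrow> 'a \<Rightarrow> real) \<Rightarrow> 'a \<Rightarrow> ('a + (nat \<Rightarrow> 'a) set) set" where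
  "gromov_points d w = range Inl \<union> Inr ` gromov_boundary d w"

fun gromov_reps :: "'a + (nat \<Rightarrow> 'a) set \<Rightarrow> (nat \<Rightarrow> 'a) set" where
  "gromov_reps (Inl x) = {\<lambda>_. x}"
| "gromov_reps (Inr \<xi>) = \<xi>"

definition ext_gromov_product ::
    "('a \<Rightarrow> 'a \<Rightarrow> real) \<Rightarrow> 'a \<Rightarrow> 'a + (nat \<Rightarrow> 'a) set \<Rightarrow> 'a + (nat \<Rightarrow> 'a) set \<Rightarrow> ereal" where
  "ext_gromov_product d w p q =
     (INF s\<in>gromov_reps p. INF t\<in>gromov_reps q.
        liminf (\<lambda>n. ereal (gromov_product d w (s n) (t n))))"

text \<open>
  The usual topology: group elements are isolated, and the sets
  \<open>{p. (\<xi>, p)\<^sub>w > R}\<close> with \<open>R\<close> real form a neighbourhood basis of a boundary point \<open>\<xi>\<close>.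
\<close>

definition gromov_open ::
    "('a \<Rightarrow> 'a \<Rightarrow> real) \<Rightarrow> 'a \<Rightarrow> ('a + (nat \<Rightarrow> 'a) set) set \<Rightarrow> bool" where
  "gromov_open d w U \<longleftrightarrow>
     U \<subseteq> gromov_points d w \<and>
     (\<forall>\<xi>. Inr \<xi> \<in> U \<longrightarrow>
        (\<exists>R::real. {p \<in> gromov_points d w. ext_gromov_product d w (Inr \<xi>) p > ereal R} \<subseteq> U))"

definition gromov_compactification ::
    "('a \<Rightarrow> 'a \<Rightarrow> real) \<Rightarrow> 'a \<Rightarrow> ('a + (nat \<Rightarrow> 'a) set) topology" where
  "gromov_compactification d w = topology (gromov_open d w)"

lemma istopology_gromov_open: "istopology (gromov_open d w)"
proof -
  have "gromov_open d w (U \<inter> V)" if U: "gromov_open d w U" and V: "gromov_open d w V" for U V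
    unfolding gromov_open_def
  proof (intro conjI allI impI)
    show "U \<inter> V \<subseteq> gromov_points d w"
      using U unfolding gromov_open_def by blast
  next
    fix \<xi> :: "(nat \<Rightarrow> 'a) set"
    assume "Inr \<xi> \<in> U \<inter> V"
    then obtain R R' :: real
      where R: "{p \<in> gromov_points d w. ext_gromov_product d w (Inr \<xi>) p > ereal R} \<subseteq> U"
        and R': "{p \<in> gromov_points d w. ext_gromov_product d w (Inr \<xi>) p > ereal R'} \<subseteq> V"
      using U V unfolding gromov_open_def by blast
    have le: "ereal R \<le> ereal (max R R')" "ereal R' \<le> ereal (max R R')"
      by auto
    have "{p \<in> gromov_points d w. ext_gromov_product d w (Inr \<xi>) p > ereal (max R R')} \<subseteq> U \<inter> V"
      using R R' le[THEN le_less_trans] by blast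
    then show "\<exists>R::real. {p \<in> gromov_points d w. ext_gromov_product d w (Inr \<xi>) p > ereal R} \<subseteq> U \<inter> V"
      by blast
  qed
  moreover have "gromov_open d w (\<Union>K)" if K: "\<forall>U\<in>K. gromov_open d w U" for K
    unfolding gromov_open_def
  proof (intro conjI allI impI)
    show "\<Union>K \<subseteq> gromov_points d w"
      using K unfolding gromov_open_def by blast
  next
    fix \<xi> :: "(nat \<Rightarrow> 'a) set"
    assume "Inr \<xi> \<in> \<Union>K"
    then obtain U where "U \<in> K" "Inr \<xi> \<in> U" by blast
    moreover from this K obtain R :: real
      where "{p \<in> gromov_points d w. ext_gromov_product d w (Inr \<xi>) p > ereal R} \<subseteq> U"
      unfolding gromov_open_def by blast
    ultimately show "\<exists>R::real. {p \<in> gromov_points d w. ext_gromov_product d w (Inr \<xi>) p > ereal R} \<subseteq> \<Union>K"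
      by blast
  qed
  ultimately show ?thesis
    unfolding istopology_def by blast
qed

lemma openin_gromov_compactification:
  "openin (gromov_compactification d w) U \<longleftrightarrow> gromov_open d w U"
  unfolding gromov_compactification_def
  by (simp add: topology_inverse' istopology_gromov_open)

lemma topspace_gromov_compactification:
  "topspace (gromov_compactification d w) = gromov_points d w"
proof
  show "topspace (gromov_compactification d w) \<subseteq> gromov_points d w"
    unfolding topspace_def by (auto simp: openin_gromov_compactification gromov_open_def)
  have "gromov_open d w (gromov_points d w)"
    unfolding gromov_open_def by blast
  then show "gromov_points d w \<subseteq> topspace (gromov_compactification d w)"
    by (simp add: openin_subset openin_gromov_compactification)
qed

fun gromov_act :: "'a::group_add \<Rightarrow> 'a + (nat \<Rightarrow> 'a) set \<Rightarrow> 'a + (nat \<Rightarrow> 'a) set" where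
  "gromov_act g (Inl x) = Inl (g + x)"
| "gromov_act g (Inr \<xi>) = Inr ((\<lambda>s n. g + s n) ` \<xi>)"

section \<open>Busemann compactification and Assumption (BA)\<close>

definition horofunction :: "('a \<Rightarrow> 'a \<Rightarrow> real) \<Rightarrow> 'a \<Rightarrow> 'a \<Rightarrow> ('a \<Rightarrow> real)" where
  "horofunction d w x = (\<lambda>y. d y x - d w x)"

text \<open>The topology of the function type \<open>'a \<Rightarrow> real\<close> is that of pointwise convergence.\<close>

definition busemann_compactification ::
    "('a \<Rightarrow> 'a \<Rightarrow> real) \<Rightarrow> 'a \<Rightarrow> ('a \<Rightarrow> real) topology" where
  "busemann_compactification d w = top_of_set (closure (range (horofunction d w)))"

text \<open>
  The continuous extension of \<open>k\<^sub>x \<mapsto> k\<^sub>g\<^sub>x\<close>; for left-invariant \<open>d\<close> it sends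
  \<open>horofunction d w x\<close> to \<open>horofunction d w (g + x)\<close>.
\<close>

definition busemann_act :: "'a::group_add \<Rightarrow> 'a \<Rightarrow> ('a \<Rightarrow> real) \<Rightarrow> ('a \<Rightarrow> real)" where
  "busemann_act w g h = (\<lambda>y. h (- g + y) - h (- g + w))"

lemma busemann_act_horofunction:
  assumes "\<And>g x y. d (g + x) (g + y) = d x y"
  shows "busemann_act w g (horofunction d w x) = horofunction d w (g + x)"
proof -
  have "d (- g + y) x = d y (g + x)" for y
    using assms[of g "- g + y" x] by (simp add: add.assoc [symmetric])
  then show ?thesis
    by (simp add: busemann_act_def horofunction_def fun_eq_iff)
qed

text \<open>The base point of both compactifications is the neutral element.\<close>

definition assumption_BA :: "('a::group_add \<Rightarrow> 'a \<Rightarrow> real) \<Rightarrow> bool" where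
  "assumption_BA d \<longleftrightarrow>
     (\<exists>\<Phi>. homeomorphic_map (gromov_compactification d 0) (busemann_compactification d 0) \<Phi> \<and>
        (\<forall>g. \<forall>p\<in>topspace (gromov_compactification d 0).
           \<Phi> (gromov_act g p) = busemann_act 0 g (\<Phi> p)))"

section \<open>Random walks\<close>

definition symmetric_set :: "'a::group_add set \<Rightarrow> bool" where
  "symmetric_set S \<longleftrightarrow> (\<forall>x\<in>S. - x \<in> S)"

text \<open>The set \<open>\<P>\<^sub>s(S)\<close>.\<close>

definition sym_pmfs :: "'a::group_add set \<Rightarrow> 'a pmf set" where
  "sym_pmfs S = {\<mu>. set_pmf \<mu> = S \<and> (\<forall>x. pmf \<mu> (- x) = pmf \<mu> x)}"

definition convolution_pmf :: "'a::group_add pmf \<Rightarrow> 'a pmf \<Rightarrow> 'a pmf" where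
  "convolution_pmf \<mu> \<mu>' = map_pmf (\<lambda>(x, y). x + y) (pair_pmf \<mu> \<mu>')"

primrec convolution_power :: "'a::group_add pmf \<Rightarrow> nat \<Rightarrow> 'a pmf" where
  "convolution_power \<mu> 0 = return_pmf 0"
| "convolution_power \<mu> (Suc n) = convolution_pmf (convolution_power \<mu> n) \<mu>"

definition rate_of_escape :: "'a::group_add pmf \<Rightarrow> ('a \<Rightarrow> 'a \<Rightarrow> real) \<Rightarrow> real" where
  "rate_of_escape \<mu> d =
     lim (\<lambda>n. (1 / real n) * (\<Sum>\<^sub>\<infinity>x. d 0 x * pmf (convolution_power \<mu> n) x))"

text \<open>
  The random walk is realised on the space of its increment sequences: for \<open>\<omega> :: nat \<Rightarrow> 'a\<close> the
  increment \<open>X\<^sub>n\<close>, \<open>n \<ge> 1\<close>, is \<open>\<omega> (n - 1)\<close>.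
\<close>

definition walk_measure :: "'a pmf \<Rightarrow> (nat \<Rightarrow> 'a) measure" where
  "walk_measure \<mu> = (\<Pi>\<^sub>M n\<in>UNIV. measure_pmf \<mu>)"

primrec walk :: "nat \<Rightarrow> (nat \<Rightarrow> 'a::group_add) \<Rightarrow> 'a" where
  "walk 0 \<omega> = 0"
| "walk (Suc n) \<omega> = walk n \<omega> + \<omega> n"

definition increment :: "nat \<Rightarrow> (nat \<Rightarrow> 'a::group_add) \<Rightarrow> 'a" where
  "increment n \<omega> = - walk (n - 1) \<omega> + walk n \<omega>"

lemma increment_eq: "n \<ge> 1 \<Longrightarrow> increment n \<omega> = \<omega> (n - 1)"
  by (cases n) (simp_all add: increment_def add.assoc [symmetric])

definition walk_martingale :: "('a::group_add \<Rightarrow> real) \<Rightarrow> nat \<Rightarrow> (nat \<Rightarrow> 'a) \<Rightarrow> real" where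
  "walk_martingale \<nu> n \<omega> = (\<Sum>j=1..n. \<nu> (increment j \<omega>))"

definition asymptotic_covariance ::
    "('a::group_add \<Rightarrow> real) \<Rightarrow> 'a pmf \<Rightarrow> ('a \<Rightarrow> 'a \<Rightarrow> real) \<Rightarrow> real" where
  "asymptotic_covariance \<nu> \<mu> d =
     lim (\<lambda>n. (1 / real n) *
       (LINT \<omega>|walk_measure \<mu>. d 0 (walk n \<omega>) * walk_martingale \<nu> n \<omega>))"

end

theory Submission
  imports Defs "HOL-Real_Asymp.Real_Asymp"
begin

text \<open>
  Nonamenability gives a spectral gap, hence a bound \<open>\<rho>\<^sup>n\<close> on the probabilities \<open>P(Z\<^sub>n = z)\<close> that is
  uniform over the symmetric weights bounded below on \<open>S\<close>. If the Gromov product \<open>(x, Z\<^sub>n)\<^sub>0\<close> exceeds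
  \<open>r\<close>, then some \<open>Z\<^sub>j\<close> lies within a distance logarithmic in \<open>j\<close> of the point at height \<open>r\<close> between
  \<open>0\<close> and \<open>x\<close>, and \<open>j\<close> is at least of order \<open>r\<close>; summing \<open>\<rho>\<^sup>j\<close> over these events bounds
  \<open>E (x, Z\<^sub>n)\<^sub>0\<close> by a constant \<open>C\<close>, uniformly in \<open>x\<close> and \<open>n\<close>. Consequently \<open>E |Z\<^sub>n|\<close> differs from
  \<open>n \<ell>\<close> by at most \<open>2C\<close>, the variance of \<open>|Z\<^sub>n|\<close> is \<open>O(n)\<close>, and \<open>E |Z\<^sub>n| M\<^sub>n\<close> is additive up to
  \<open>O(\<surd>n)\<close>. Expanding the density of the law of the first \<open>n\<close> steps under \<open>\<mu>\<^sub>t\<close> with respect to that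
  under \<open>\<mu>\<^sub>0\<close> to first order gives
  \<open>n (\<ell>\<^sub>t - \<ell>\<^sub>0) = t E |Z\<^sub>n| M\<^sub>n + O(1) + O(n\<^sup>3\<^sup>/\<^sup>2 t\<^sup>2) + n o(t)\<close>, and one lets \<open>n\<close> grow like \<open>|t|\<^sup>-\<^sup>3\<^sup>/\<^sup>2\<close>.
\<close>

section \<open>Expectations over words\<close>

text \<open>The rate of escape is itself a limit in \<open>n\<close>, so differentiating it in
  \<open>t\<close> would require an exchange of limits. Instead, the parameters \<open>t\<close> and
  \<open>0\<close> are compared at one common finite time \<open>n\<close>. This needs the error
  \<open>2 * C / n\<close> of the approximate rate with the same \<open>C\<close> for all
  \<open>t\<close> near \<open>0\<close>, so \<open>C\<close> and \<open>D\<close> are fixed before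
  the weights are chosen. After division by \<open>n * t\<close>, the rate error is of order 1 / (n
  |t|) and forces n |t| to infinity. With the trivial bound |Z_n| <= D n, the second-order term of
  the density would cost n |t|, which is incompatible. Only the fluctuation of |Z_n| matters there,
  because that term has mean 0; having order sqrt n, it lowers the cost to sqrt n |t| and opens the
  window between 1 / |t| and 1 / t^2. The same gain handles the remainder of the curve at
  \<open>0\<close>: it is o(t) without any rate, so no positive power of \<open>n\<close> may be
  left in front of it. Expectations are finite sums over words; measure theory enters only when the
  walk measure is identified with them.\<close>

primrec word_expectation :: "'a set \<Rightarrow> ('a \<Rightarrow> real) \<Rightarrow> nat \<Rightarrow> ('a list \<Rightarrow> real) \<Rightarrow> real" where
  "word_expectation S p 0 F = F []"
| "word_expectation S p (Suc n) F = (\<Sum>a\<in>S. p a * word_expectation S p n (\<lambda>w. F (a # w)))"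

lemma word_expectation_cong:
  assumes "\<And>w. length w = n \<Longrightarrow> set w \<subseteq> S \<Longrightarrow> F w = G w"
  shows "word_expectation S p n F = word_expectation S p n G"
  using assms
proof (induction n arbitrary: F G)
  case (Suc n)
  have "word_expectation S p n (\<lambda>w. F (a # w)) = word_expectation S p n (\<lambda>w. G (a # w))" if "a \<in> S" for a
    by (rule Suc.IH) (use that Suc.prems in auto)
  then show ?case
    by (simp cong: sum.cong)
qed simp

lemma word_expectation_add:
  "word_expectation S p n (\<lambda>w. F w + G w) = word_expectation S p n F + word_expectation S p n G"
  by (induction n arbitrary: F G) (simp_all add: distrib_left sum.distrib)

lemma word_expectation_cmult:
  "word_expectation S p n (\<lambda>w. c * F w) = c * word_expectation S p n F"
  by (induction n arbitrary: F) (simp_all add: sum_distrib_left mult.left_commute)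

lemma word_expectation_diff:
  "word_expectation S p n (\<lambda>w. F w - G w) = word_expectation S p n F - word_expectation S p n G"
  using word_expectation_add[of S p n F "\<lambda>w. - 1 * G w"]
    word_expectation_cmult[of S p n "- 1" G] by simp

lemma word_expectation_sum:
  "word_expectation S p n (\<lambda>w. \<Sum>i\<in>I. F i w) = (\<Sum>i\<in>I. word_expectation S p n (F i))"
proof (induction n arbitrary: F)
  case (Suc n)
  then show ?case
    by (simp add: sum_distrib_left) (rule sum.swap)
qed simp

lemma word_expectation_append:
  "word_expectation S p (m + n) F =
     word_expectation S p m (\<lambda>u. word_expectation S p n (\<lambda>v. F (u @ v)))"
  by (induction m arbitrary: F) simp_all

lemma word_expectation_Suc_snoc:
  "word_expectation S p (Suc n) F = word_expectation S p n (\<lambda>w. \<Sum>a\<in>S. p a * F (w @ [a]))"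
  using word_expectation_append[of S p n 1 F] by simp

lemma word_expectation_swap:
  "word_expectation S p m (\<lambda>u. word_expectation S p n (F u)) =
     word_expectation S p n (\<lambda>v. word_expectation S p m (\<lambda>u. F u v))"
  by (induction m arbitrary: F) (simp_all add: word_expectation_sum word_expectation_cmult)

lemma word_expectation_rev:
  "word_expectation S p n (\<lambda>w. F (rev w)) = word_expectation S p n F"
proof (induction n arbitrary: F)
  case (Suc n)
  have "word_expectation S p (Suc n) (\<lambda>w. F (rev w)) = (\<Sum>a\<in>S. p a * word_expectation S p n (\<lambda>w. F (w @ [a])))"
    by (simp add: Suc[of "\<lambda>w. F (w @ [a])" for a])
  also have "\<dots> = word_expectation S p (Suc n) F"
    by (simp only: word_expectation_Suc_snoc word_expectation_sum word_expectation_cmult)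
  finally show ?case .
qed simp

lemma word_expectation_change_weights:
  assumes "\<And>a. a \<in> S \<Longrightarrow> q a = p a * r a"
  shows "word_expectation S q n F = word_expectation S p n (\<lambda>w. prod_list (map r w) * F w)"
proof (induction n arbitrary: F)
  case (Suc n)
  then show ?case
    by (auto intro!: sum.cong simp: assms mult.assoc word_expectation_cmult)
qed simp

locale symmetric_weights =
  fixes S :: "'a::group_add set" and p :: "'a \<Rightarrow> real"
  assumes finite_S: "finite S"
    and uminus_S: "\<And>a. a \<in> S \<Longrightarrow> - a \<in> S"
    and p_nonneg: "\<And>a. a \<in> S \<Longrightarrow> 0 \<le> p a"
    and p_uminus: "\<And>a. a \<in> S \<Longrightarrow> p (- a) = p a"
    and sum_p: "sum p S = 1"
begin

abbreviation "E \<equiv> word_expectation S p"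

lemma sum_uminus_S: "(\<Sum>a\<in>S. f (- a)) = sum f S"
  using uminus_S by (intro sum.reindex_bij_witness[where i = uminus and j = uminus]) auto

lemma E_const [simp]: "E n (\<lambda>_. c) = c"
  by (induction n) (simp_all add: sum_p flip: sum_distrib_right)

lemma E_mono:
  assumes "\<And>w. length w = n \<Longrightarrow> set w \<subseteq> S \<Longrightarrow> F w \<le> G w"
  shows "E n F \<le> E n G"
  using assms
proof (induction n arbitrary: F G)
  case (Suc n)
  have "E n (\<lambda>w. F (a # w)) \<le> E n (\<lambda>w. G (a # w))" if "a \<in> S" for a
    by (rule Suc.IH) (use that Suc.prems in auto)
  then show ?case
    by (auto intro!: sum_mono mult_left_mono p_nonneg)
qed simp

lemma E_nonneg:
  assumes "\<And>w. length w = n \<Longrightarrow> set w \<subseteq> S \<Longrightarrow> 0 \<le> F w"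
  shows "0 \<le> E n F"
  using E_mono[of n "\<lambda>_. 0" F] assms by simp

lemma E_abs: "\<bar>E n F\<bar> \<le> E n (\<lambda>w. \<bar>F w\<bar>)"
proof -
  have "E n F \<le> E n (\<lambda>w. \<bar>F w\<bar>)" "E n (\<lambda>w. - 1 * F w) \<le> E n (\<lambda>w. \<bar>F w\<bar>)"
    by (intro E_mono; simp)+
  then show ?thesis
    unfolding word_expectation_cmult by simp
qed

lemma E_map_uminus: "E n (\<lambda>w. F (map uminus w)) = E n F"
proof (induction n arbitrary: F)
  case (Suc n)
  have "E (Suc n) (\<lambda>w. F (map uminus w)) = (\<Sum>a\<in>S. p (- a) * E n (\<lambda>w. F (- a # w)))"
    by (auto intro!: sum.cong simp: p_uminus Suc[of "\<lambda>w. F (- a # w)" for a])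
  also have "\<dots> = E (Suc n) F"
    using sum_uminus_S[of "\<lambda>a. p a * E n (\<lambda>w. F (a # w))"] by simp
  finally show ?case .
qed simp

text \<open>Reversing a word keeps its weight, and so does inverting its letters because
  \<open>p\<close> is symmetric; together they invert the product. This lets a Gromov product be
  averaged over the first block of a walk as well as over the second.\<close>

lemma E_inverse_walk: "E n (\<lambda>w. F (- sum_list w)) = E n (\<lambda>w. F (sum_list w))"
proof -
  have *: "- sum_list w = sum_list (map uminus (rev w))" for w :: "'a list"
    by (induction w) (simp_all add: minus_add)
  show ?thesis
    unfolding * using word_expectation_rev[of S p n "\<lambda>w. F (sum_list (map uminus w))"]
      E_map_uminus[of n "\<lambda>w. F (sum_list w)"] by simp
qed

lemma E_Cauchy_Schwarz: "(E n (\<lambda>w. F w * G w))\<^sup>2 \<le> E n (\<lambda>w. (F w)\<^sup>2) * E n (\<lambda>w. (G w)\<^sup>2)"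
proof -
  define a b c where "a = E n (\<lambda>w. (F w)\<^sup>2)" and "b = E n (\<lambda>w. F w * G w)" and "c = E n (\<lambda>w. (G w)\<^sup>2)"
  have quad: "0 \<le> s\<^sup>2 * a - 2 * s * t * b + t\<^sup>2 * c" for s t
  proof -
    have "0 \<le> E n (\<lambda>w. (s * F w - t * G w)\<^sup>2)"
      by (intro E_nonneg) simp
    also have "\<dots> = E n (\<lambda>w. s\<^sup>2 * (F w)\<^sup>2 - 2 * s * t * (F w * G w) + t\<^sup>2 * (G w)\<^sup>2)"
      by (simp add: power2_diff power_mult_distrib algebra_simps)
    also have "\<dots> = s\<^sup>2 * a - 2 * s * t * b + t\<^sup>2 * c"
      by (simp only: word_expectation_add word_expectation_diff word_expectation_cmult a_def b_def c_def)
    finally show ?thesis .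
  qed
  have a0: "0 \<le> a" and c0: "0 \<le> c"
    unfolding a_def c_def by (intro E_nonneg; simp)+
  have "b\<^sup>2 \<le> a * c"
  proof (cases "c = 0")
    case True
    \<comment> \<open>With \<open>s = 1\<close> and this value of \<open>t\<close> the form would
      equal \<open>a - (a + 1)\<close>, which is negative.\<close>
    have "b = 0"
      using quad[of 1 "(a + 1) / (2 * b)"] True by (cases "b = 0") simp_all
    then show ?thesis using True by simp
  next
    case False
    \<comment> \<open>The choice \<open>s = c\<close>, \<open>t = b\<close> is the minimising
      direction of the form, up to scale.\<close>
    have "0 \<le> c * (c * a - b\<^sup>2)" using quad[of c b] by (simp add: algebra_simps power2_eq_square)
    then show ?thesis using False c0 by (simp add: zero_le_mult_iff mult.commute)
  qed
  then show ?thesis unfolding a_def b_def c_def .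
qed

lemma E_Cauchy_Schwarz_sqrt:
  "\<bar>E n (\<lambda>w. F w * G w)\<bar> \<le> sqrt (E n (\<lambda>w. (F w)\<^sup>2)) * sqrt (E n (\<lambda>w. (G w)\<^sup>2))"
  using real_sqrt_le_mono[OF E_Cauchy_Schwarz[of n F G]]
  by (simp only: real_sqrt_mult real_sqrt_abs)

end

section \<open>Almost invariant functions and amenability\<close>

lemma finite_support_summable:
  fixes f :: "'a \<Rightarrow> real"
  shows "finite {x. f x \<noteq> 0} \<Longrightarrow> f summable_on A"
  by (rule finite_nonzero_values_imp_summable_on) (rule finite_subset[of _ "{x. f x \<noteq> 0}"], auto)

section \<open>Sums of finitely supported functions and their translates\<close>

lemma infsum_sum_swap:
  fixes f :: "'i \<Rightarrow> 'a \<Rightarrow> real"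
  assumes "finite I" "\<And>i. i \<in> I \<Longrightarrow> f i summable_on A"
  shows "infsum (\<lambda>x. \<Sum>i\<in>I. f i x) A = (\<Sum>i\<in>I. infsum (f i) A)"
proof -
  have "((\<lambda>x. \<Sum>i\<in>I. f i x) has_sum (\<Sum>i\<in>I. infsum (f i) A)) A"
    using assms by (induction I rule: finite_induct) (auto intro!: has_sum_add)
  then show ?thesis by (rule infsumI)
qed

lemma finite_support_shift:
  fixes f :: "'a::group_add \<Rightarrow> real"
  assumes "finite {x. f x \<noteq> 0}"
  shows "finite {x. f (g + x) \<noteq> 0}"
proof -
  have "{x. f (g + x) \<noteq> 0} \<subseteq> (+) (- g) ` {x. f x \<noteq> 0}"
  proof
    fix x assume "x \<in> {x. f (g + x) \<noteq> 0}"
    then show "x \<in> (+) (- g) ` {x. f x \<noteq> 0}"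
      by (intro image_eqI[of _ _ "g + x"]) (auto simp: add.assoc[symmetric])
  qed
  with assms show ?thesis
    by (meson finite_imageI finite_subset)
qed

lemma bij_plus_left: "bij ((+) (g::'a::group_add))"
  by (rule bij_betw_byWitness[where f' = "(+) (- g)"]) (auto simp: add.assoc[symmetric])

lemma infsum_shift:
  fixes f :: "'a::group_add \<Rightarrow> real"
  shows "infsum (\<lambda>x. f (g + x)) UNIV = infsum f UNIV"
  using infsum_reindex_bij_betw[OF bij_plus_left] by auto

text \<open>Reiter's condition yields an invariant mean: each \<open>f\<close> gives the mean
  \<open>A \<mapsto> infsum f A\<close>, invariant up to \<open>\<epsilon>\<close>, and compactness
  of the cube of all \<open>[0,1]\<close>-valued set functions supplies a limit.\<close>

lemma amenable_if_almost_invariant: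
  fixes S :: "'a::group_add set"
  assumes gen: "generates S"
    and inv: "\<And>\<epsilon>. \<epsilon> > 0 \<Longrightarrow> \<exists>f :: 'a \<Rightarrow> real. finite {x. f x \<noteq> 0} \<and> (\<forall>x. 0 \<le> f x) \<and> infsum f UNIV = 1
           \<and> (\<forall>s\<in>S. infsum (\<lambda>x. \<bar>f (s + x) - f x\<bar>) UNIV \<le> \<epsilon>)"
  shows "amenable TYPE('a)"
proof -
  define U where "U = {m :: 'a set \<Rightarrow> real. \<forall>A. m A \<in> {0..1}}"
  define M where "M \<epsilon> = {m :: 'a set \<Rightarrow> real. m UNIV = 1 \<and>
    (\<forall>A B. A \<inter> B = {} \<longrightarrow> m (A \<union> B) = m A + m B) \<and> (\<forall>s A. s \<in> S \<longrightarrow> \<bar>m ((+) s ` A) - m A\<bar> \<le> \<epsilon>)}" for \<epsilon>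
  \<comment> \<open>Tychonoff. Every condition in \<open>M \<epsilon>\<close> involves finitely many
    coordinates only, hence is closed for pointwise convergence.\<close>
  have "compactin (product_topology (\<lambda>_::'a set. euclidean) UNIV) (\<Pi>\<^sub>E _\<in>UNIV. {0..1::real})"
    by (simp add: compactin_PiE)
  then have U: "compact U"
    by (simp add: euclidean_product_topology U_def PiE_UNIV_domain Pi_def del: atLeastAtMost_iff)
  have cont [continuous_intros]: "continuous_on T (\<lambda>m :: 'a set \<Rightarrow> real. m A)" for A T
    by (rule continuous_on_product_coordinates[THEN continuous_on_subset]) simp
  have M_closed: "closed (M \<epsilon>)" for \<epsilon>
    unfolding M_def
    by (intro closed_Collect_conj closed_Collect_all closed_Collect_imp closed_Collect_eq closed_Collect_le
        open_Collect_const continuous_intros)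
  have M_nonempty: "U \<inter> M \<epsilon> \<noteq> {}" if "\<epsilon> > 0" for \<epsilon>
  proof -
    obtain f :: "'a \<Rightarrow> real" where f: "finite {x. f x \<noteq> 0}" "\<And>x. 0 \<le> f x" "infsum f UNIV = 1"
      and small: "\<And>s. s \<in> S \<Longrightarrow> infsum (\<lambda>x. \<bar>f (s + x) - f x\<bar>) UNIV \<le> \<epsilon>"
      using inv[OF \<open>\<epsilon> > 0\<close>] by blast
    define m where "m A = infsum f A" for A
    have summ: "f summable_on A" for A by (rule finite_support_summable[OF f(1)])
    have "m A \<in> {0..1}" for A
      using infsum_mono_neutral[OF summ summ, of A UNIV] f by (auto simp: m_def infsum_nonneg)
    moreover have "m (A \<union> B) = m A + m B" if "A \<inter> B = {}" for A B
      unfolding m_def by (rule infsum_Un_disjoint[OF summ summ that])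
    moreover have "\<bar>m ((+) s ` A) - m A\<bar> \<le> \<epsilon>" if s: "s \<in> S" for s A
    proof -
      have eq: "m ((+) s ` A) = infsum (\<lambda>x. f (s + x)) A"
        unfolding m_def by (subst infsum_reindex) (auto simp: o_def inj_on_def)
      have fs: "finite {x. f (s + x) \<noteq> 0}" by (rule finite_support_shift[OF f(1)])
      have "finite {x. \<bar>f (s + x) - f x\<bar> \<noteq> 0}"
        by (rule finite_subset[OF _ finite_UnI[OF fs f(1)]]) auto
      then have sa: "(\<lambda>x. \<bar>f (s + x) - f x\<bar>) summable_on B" for B
        by (rule finite_support_summable)
      have "m ((+) s ` A) - m A = infsum (\<lambda>x. f (s + x) - f x) A"
        unfolding eq unfolding m_def
        using infsum_add[of "\<lambda>x. f (s + x)" A "\<lambda>x. - f x"] f(1) fs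
        by (simp add: infsum_uminus finite_support_summable summable_on_uminus)
      also have "\<bar>\<dots>\<bar> \<le> infsum (\<lambda>x. \<bar>f (s + x) - f x\<bar>) A"
        using norm_infsum_bound[of "\<lambda>x. f (s + x) - f x" A] sa[of A] by simp
      also have "\<dots> \<le> infsum (\<lambda>x. \<bar>f (s + x) - f x\<bar>) UNIV"
        by (rule infsum_mono_neutral[OF sa sa]) auto
      finally show ?thesis using small[OF s] by simp
    qed
    ultimately have "m \<in> U \<inter> M \<epsilon>"
      using f(3) by (simp add: U_def M_def m_def)
    then show ?thesis by blast
  qed
  have "U \<inter> (\<Inter>n. M (1 / Suc n)) \<noteq> {}"
  proof (rule compact_imp_fip_image[OF U M_closed])
    fix I :: "nat set" assume "finite I"
    \<comment> \<open>The sets decrease with \<open>n\<close>, so the one of largest index lies in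
      the finite intersection; \<open>0\<close> is inserted to make \<open>Max\<close> meaningful
      when \<open>I\<close> is empty.\<close>
    have "M (1 / Suc (Max (insert 0 I))) \<subseteq> M (1 / Suc n)" if "n \<in> I" for n
    proof -
      have "1 / real (Suc (Max (insert 0 I))) \<le> 1 / real (Suc n)"
        using \<open>finite I\<close> that by (intro divide_left_mono) auto
      then show ?thesis
        unfolding M_def by (blast intro: order_trans)
    qed
    then show "U \<inter> (\<Inter>n\<in>I. M (1 / Suc n)) \<noteq> {}"
      using M_nonempty[of "1 / Suc (Max (insert 0 I))"] by fastforce
  qed
  then obtain m where m: "m \<in> U" "\<And>n. m \<in> M (1 / Suc n)" by blast
  have inv_S: "m ((+) s ` A) = m A" if "s \<in> S" for s A
  proof (rule ccontr)
    assume "m ((+) s ` A) \<noteq> m A"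
    then obtain n where "1 / Suc n < \<bar>m ((+) s ` A) - m A\<bar>"
      using nat_approx_posE[of "\<bar>m ((+) s ` A) - m A\<bar>"] by auto
    moreover have "\<bar>m ((+) s ` A) - m A\<bar> \<le> 1 / Suc n"
      using m(2)[of n] that unfolding M_def by blast
    ultimately show False by simp
  qed
  have inv_mS: "m ((+) s ` A) = m A" if "s \<in> S \<union> uminus ` S" for s A
  proof (cases "s \<in> S")
    case False
    then obtain t where "t \<in> S" "s = - t" using \<open>s \<in> _\<close> by blast
    then show ?thesis
      using inv_S[of t "(+) s ` A"] by (simp add: image_image add.assoc[symmetric])
  qed (rule inv_S)
  have "m ((+) g ` A) = m A" for g A
  proof -
    obtain xs where "set xs \<subseteq> S \<union> uminus ` S" "sum_list xs = g"
      using gen unfolding generates_def by blast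
    then show ?thesis
    proof (induction xs arbitrary: g)
      case (Cons a xs)
      have "m ((+) g ` A) = m ((+) a ` ((+) (sum_list xs) ` A))"
        using Cons.prems by (auto simp: image_image add.assoc)
      also have "\<dots> = m A"
        using Cons inv_mS[of a] by simp
      finally show ?case .
    qed simp
  qed
  then show ?thesis
    unfolding amenable_def using m(2)[of 0] m(1) unfolding M_def U_def by (intro exI[of _ m]) auto
qed

text \<open>If no \<open>\<epsilon>\<close> worked, functions violating the inequality, rescaled to
  total mass 1, would be almost invariant under every \<open>s\<close>, since each summand is at
  most the sum over \<open>S\<close>.\<close>

lemma nonamenable_l1_inequality:
  fixes S :: "'a::group_add set"
  assumes "\<not> amenable TYPE('a)" "finite S" "generates S"
  obtains \<epsilon> where "\<epsilon> > 0" "\<And>f :: 'a \<Rightarrow> real. finite {x. f x \<noteq> 0} \<Longrightarrow> (\<And>x. 0 \<le> f x) \<Longrightarrow>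
     \<epsilon> * infsum f UNIV \<le> (\<Sum>s\<in>S. infsum (\<lambda>x. \<bar>f (s + x) - f x\<bar>) UNIV)"
proof (rule ccontr)
  assume no: "\<not> thesis"
  have "amenable TYPE('a)"
  proof (rule amenable_if_almost_invariant[OF \<open>generates S\<close>])
    fix \<epsilon> :: real assume "\<epsilon> > 0"
    with no that obtain f :: "'a \<Rightarrow> real" where f: "finite {x. f x \<noteq> 0}" "\<And>x. 0 \<le> f x"
      and lt: "(\<Sum>s\<in>S. infsum (\<lambda>x. \<bar>f (s + x) - f x\<bar>) UNIV) < \<epsilon> * infsum f UNIV"
      by (meson not_le)
    have le: "infsum (\<lambda>x. \<bar>f (s + x) - f x\<bar>) UNIV \<le> \<epsilon> * infsum f UNIV" if "s \<in> S" for s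
    proof -
      have "infsum (\<lambda>x. \<bar>f (s + x) - f x\<bar>) UNIV \<le> (\<Sum>s\<in>S. infsum (\<lambda>x. \<bar>f (s + x) - f x\<bar>) UNIV)"
        using that \<open>finite S\<close> by (intro member_le_sum infsum_nonneg) auto
      with lt show ?thesis by simp
    qed
    have "0 \<le> (\<Sum>s\<in>S. infsum (\<lambda>x. \<bar>f (s + x) - f x\<bar>) UNIV)"
      by (intro sum_nonneg infsum_nonneg) auto
    with lt \<open>\<epsilon> > 0\<close> have pos: "infsum f UNIV > 0"
      by (smt (verit) mult_nonneg_nonpos)
    define c where "c = 1 / infsum f UNIV"
    have c: "c > 0" using pos by (simp add: c_def)
    have "infsum (\<lambda>x. \<bar>c * f (s + x) - c * f x\<bar>) UNIV \<le> \<epsilon>" if "s \<in> S" for s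
    proof -
      have "(\<lambda>x. \<bar>c * f (s + x) - c * f x\<bar>) = (\<lambda>x. c * \<bar>f (s + x) - f x\<bar>)"
        using c by (auto simp: abs_mult simp flip: right_diff_distrib)
      then show ?thesis
        using le[OF that] pos by (simp only: infsum_cmult_right') (simp add: c_def pos_divide_le_eq)
    qed
    then show "\<exists>f. finite {x. f x \<noteq> 0} \<and> (\<forall>x. 0 \<le> f x) \<and> infsum f UNIV = 1 \<and>
               (\<forall>s\<in>S. infsum (\<lambda>x. \<bar>f (s + x) - f x\<bar>) UNIV \<le> \<epsilon>)"
      using f c pos infsum_cmult_right'[of c f UNIV]
      by (intro exI[of _ "\<lambda>x. c * f x"]) (simp add: c_def)
  qed
  with assms show False by simp
qed

text \<open>Cheeger's argument: the l1 inequality is applied to the square of \<open>g\<close>,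
  whose increments factor into a difference of values of \<open>g\<close> times their sum, and a
  weighted arithmetic-geometric inequality separates the two factors.\<close>

lemma nonamenable_Dirichlet_inequality:
  fixes S :: "'a::group_add set"
  assumes "\<not> amenable TYPE('a)" "finite S" "generates S" "S \<noteq> {}"
  obtains \<kappa> where "\<kappa> > 0" "\<And>g :: 'a \<Rightarrow> real. finite {x. g x \<noteq> 0} \<Longrightarrow>
     \<kappa> * infsum (\<lambda>x. (g x)\<^sup>2) UNIV \<le> (\<Sum>s\<in>S. infsum (\<lambda>x. (g (s + x) - g x)\<^sup>2) UNIV)"
proof -
  obtain \<epsilon> where \<epsilon>: "\<epsilon> > 0" and l1: "\<And>f :: 'a \<Rightarrow> real. finite {x. f x \<noteq> 0} \<Longrightarrow> (\<And>x. 0 \<le> f x) \<Longrightarrow>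
     \<epsilon> * infsum f UNIV \<le> (\<Sum>s\<in>S. infsum (\<lambda>x. \<bar>f (s + x) - f x\<bar>) UNIV)"
    using nonamenable_l1_inequality[OF assms(1-3)] by blast
  define k where "k = real (card S)"
  have k: "k > 0" using assms by (simp add: k_def card_gt_0_iff)
  \<comment> \<open>Over the \<open>k\<close> generators the terms \<open>2 * \<eta> * G\<close> add
    up to \<open>\<epsilon> / 2 * G\<close>, which the left-hand side absorbs.\<close>
  define \<eta> where "\<eta> = \<epsilon> / (4 * k)"
  have \<eta>: "\<eta> > 0" using \<epsilon> k by (simp add: \<eta>_def)
  have "\<epsilon> * \<eta> * infsum (\<lambda>x. (g x)\<^sup>2) UNIV \<le> (\<Sum>s\<in>S. infsum (\<lambda>x. (g (s + x) - g x)\<^sup>2) UNIV)"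
    if g: "finite {x. g x \<noteq> 0}" for g :: "'a \<Rightarrow> real"
  proof -
    define G where "G = infsum (\<lambda>x. (g x)\<^sup>2) UNIV"
    define D where "D s = infsum (\<lambda>x. (g (s + x) - g x)\<^sup>2) UNIV" for s
    have amgm: "\<bar>u\<^sup>2 - v\<^sup>2\<bar> \<le> (u - v)\<^sup>2 / (2 * \<eta>) + \<eta> * (u\<^sup>2 + v\<^sup>2)" for u v :: real
    proof -
      have "2 * \<eta> * \<bar>u\<^sup>2 - v\<^sup>2\<bar> = 2 * \<bar>u - v\<bar> * (\<eta> * \<bar>u + v\<bar>)"
        by (simp add: power2_eq_square square_diff_square_factored abs_mult)
      also have "\<dots> \<le> \<bar>u - v\<bar>\<^sup>2 + (\<eta> * \<bar>u + v\<bar>)\<^sup>2"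
        by (rule sum_squares_bound)
      also have "\<dots> = (u - v)\<^sup>2 + \<eta>\<^sup>2 * (u + v)\<^sup>2"
        by (simp add: power_mult_distrib)
      also have "\<dots> \<le> (u - v)\<^sup>2 + \<eta>\<^sup>2 * (2 * (u\<^sup>2 + v\<^sup>2))"
        using sum_squares_bound[of u v] by (intro add_left_mono mult_left_mono) (auto simp: power2_sum)
      finally show ?thesis using \<eta> by (simp add: field_simps power2_eq_square)
    qed
    have fin: "finite {x. g (s + x) \<noteq> 0}" for s by (rule finite_support_shift[OF g])
    have summ: "F summable_on UNIV" if "\<And>x. g x = 0 \<Longrightarrow> g (s + x) = 0 \<Longrightarrow> F x = 0" for F :: "'a \<Rightarrow> real" and s
      using that by (intro finite_support_summable finite_subset[OF _ finite_UnI[OF fin[of s] g]]) auto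
    have "infsum (\<lambda>x. \<bar>(g (s + x))\<^sup>2 - (g x)\<^sup>2\<bar>) UNIV \<le> D s / (2 * \<eta>) + 2 * \<eta> * G" for s
    proof -
      have "infsum (\<lambda>x. \<bar>(g (s + x))\<^sup>2 - (g x)\<^sup>2\<bar>) UNIV
        \<le> infsum (\<lambda>x. 1 / (2 * \<eta>) * (g (s + x) - g x)\<^sup>2 + \<eta> * ((g (s + x))\<^sup>2 + (g x)\<^sup>2)) UNIV"
        by (rule infsum_mono) (use amgm in \<open>auto intro!: summ[of s]\<close>)
      also have "\<dots> = 1 / (2 * \<eta>) * D s + \<eta> * (infsum (\<lambda>x. (g (s + x))\<^sup>2) UNIV + G)"
        unfolding D_def G_def
        by (subst infsum_add, (rule summ[of s]; simp)+, subst infsum_cmult_right', subst infsum_cmult_right',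
            subst infsum_add, (rule summ[of s]; simp)+, rule refl)
      also have "infsum (\<lambda>x. (g (s + x))\<^sup>2) UNIV = G"
        unfolding G_def by (rule infsum_shift[where f = "\<lambda>x. (g x)\<^sup>2"])
      finally show ?thesis by simp
    qed
    then have "(\<Sum>s\<in>S. infsum (\<lambda>x. \<bar>(g (s + x))\<^sup>2 - (g x)\<^sup>2\<bar>) UNIV) \<le> (\<Sum>s\<in>S. D s / (2 * \<eta>) + 2 * \<eta> * G)"
      by (rule sum_mono)
    also have "\<dots> = (\<Sum>s\<in>S. D s) / (2 * \<eta>) + \<epsilon> / 2 * G"
      using k by (simp add: sum.distrib \<eta>_def flip: k_def sum_divide_distrib sum_distrib_right)
    finally have "\<epsilon> * G \<le> (\<Sum>s\<in>S. D s) / (2 * \<eta>) + \<epsilon> / 2 * G"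
      using l1[of "\<lambda>x. (g x)\<^sup>2"] g by (auto simp: G_def)
    then have "\<epsilon> / 2 * G \<le> (\<Sum>s\<in>S. D s) / (2 * \<eta>)" by simp
    then show ?thesis
      unfolding G_def[symmetric] D_def[symmetric] using \<eta> by (simp add: field_simps)
  qed
  then show thesis using that[of "\<epsilon> * \<eta>"] \<epsilon> \<eta> by simp
qed

section \<open>The spectral gap of the symmetric walks\<close>

context symmetric_weights
begin

text \<open>Generators act on the left, to match the translates used for amenability. By symmetry of
  \<open>p\<close> this is also the recursion for the law of the walk when its first letter is split
  off.\<close>

definition markov :: "('a \<Rightarrow> real) \<Rightarrow> 'a \<Rightarrow> real" where
  "markov g x = (\<Sum>s\<in>S. p s * g (s + x))"

lemma finite_support_markov:
  assumes "finite {x. g x \<noteq> 0}"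
  shows "finite {x. markov g x \<noteq> 0}"
proof (rule finite_subset)
  have "markov g x = 0" if "\<And>s. s \<in> S \<Longrightarrow> g (s + x) = 0" for x
    using that by (simp add: markov_def)
  then show "{x. markov g x \<noteq> 0} \<subseteq> (\<Union>s\<in>S. {x. g (s + x) \<noteq> 0})"
    by blast
  show "finite (\<Union>s\<in>S. {x. g (s + x) \<noteq> 0})"
    by (intro finite_UN_I finite_S finite_support_shift assms)
qed

lemma infsum_markov:
  assumes g: "finite {x. g x \<noteq> 0}"
  shows "infsum (\<lambda>x. markov g x * h x) UNIV = (\<Sum>s\<in>S. p s * infsum (\<lambda>x. g (s + x) * h x) UNIV)"
proof -
  have "(\<lambda>x. p s * (g (s + x) * h x)) summable_on UNIV" for s
    by (intro finite_support_summable finite_subset[OF _ finite_support_shift[OF g, of s]]) auto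
  then show ?thesis
    unfolding markov_def sum_distrib_right mult.assoc
    by (simp add: infsum_sum_swap finite_S infsum_cmult_right')
qed

lemma markov_symmetric:
  assumes g: "finite {x. g x \<noteq> 0}" and h: "finite {x. h x \<noteq> 0}"
  shows "infsum (\<lambda>x. markov g x * h x) UNIV = infsum (\<lambda>x. g x * markov h x) UNIV"
proof -
  have "infsum (\<lambda>x. g (s + x) * h x) UNIV = infsum (\<lambda>x. h (- s + x) * g x) UNIV" for s
    using infsum_shift[of "\<lambda>x. h (- s + x) * g x" s] by (simp add: add.assoc[symmetric] mult.commute)
  then have "infsum (\<lambda>x. markov g x * h x) UNIV = (\<Sum>s\<in>S. p (- s) * infsum (\<lambda>x. h (- s + x) * g x) UNIV)"
    unfolding infsum_markov[OF g] by (intro sum.cong) (simp_all add: p_uminus)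
  also have "\<dots> = infsum (\<lambda>x. markov h x * g x) UNIV"
    unfolding infsum_markov[OF h]
    by (rule sum_uminus_S[of "\<lambda>s. p s * infsum (\<lambda>x. h (s + x) * g x) UNIV"])
  finally show ?thesis by (simp only: mult.commute)
qed

text \<open>Passing to the absolute value \<open>a\<close> of \<open>g\<close> bounds the form from
  above and below at once, so the bottom of the spectrum is controlled as well as the top. For
  \<open>a\<close> the form is the squared norm minus half the \<open>p\<close>-weighted Dirichlet
  sums, and \<open>c \<le> p s\<close> makes \<open>\<kappa>\<close> applicable.\<close>

lemma markov_quadratic_form_bound:
  assumes c: "0 \<le> c" "\<And>s. s \<in> S \<Longrightarrow> c \<le> p s"
    and \<kappa>: "\<And>g :: 'a \<Rightarrow> real. finite {x. g x \<noteq> 0} \<Longrightarrow>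
       \<kappa> * infsum (\<lambda>x. (g x)\<^sup>2) UNIV \<le> (\<Sum>s\<in>S. infsum (\<lambda>x. (g (s + x) - g x)\<^sup>2) UNIV)"
    and g: "finite {x. g x \<noteq> 0}"
  shows "\<bar>infsum (\<lambda>x. markov g x * g x) UNIV\<bar> \<le> (1 - c * \<kappa> / 2) * infsum (\<lambda>x. (g x)\<^sup>2) UNIV"
proof -
  define a where "a x = \<bar>g x\<bar>" for x
  have a: "finite {x. a x \<noteq> 0}" using g by (simp add: a_def)
  define G where "G = infsum (\<lambda>x. (g x)\<^sup>2) UNIV"
  define D where "D s = infsum (\<lambda>x. (a (s + x) - a x)\<^sup>2) UNIV" for s
  have fin: "finite {x. a (s + x) \<noteq> 0}" for s by (rule finite_support_shift[OF a])
  have summ: "F summable_on UNIV" if "\<And>x. a x = 0 \<Longrightarrow> a (s + x) = 0 \<Longrightarrow> F x = 0" for F :: "'a \<Rightarrow> real" and s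
    using that by (intro finite_support_summable finite_subset[OF _ finite_UnI[OF fin[of s] a]]) auto
  have Ga: "infsum (\<lambda>x. (a x)\<^sup>2) UNIV = G"
    by (simp add: a_def G_def)
  have Ga': "infsum (\<lambda>x. (a (s + x))\<^sup>2) UNIV = G" for s
    using infsum_shift[of "\<lambda>x. (a x)\<^sup>2" s] Ga by simp
  have D: "D s = 2 * G - 2 * infsum (\<lambda>x. a (s + x) * a x) UNIV" for s
  proof -
    have "D s = infsum (\<lambda>x. ((a (s + x))\<^sup>2 + (a x)\<^sup>2) + - 2 * (a (s + x) * a x)) UNIV"
      unfolding D_def by (simp add: power2_diff algebra_simps)
    also have "\<dots> = infsum (\<lambda>x. (a (s + x))\<^sup>2 + (a x)\<^sup>2) UNIV + infsum (\<lambda>x. - 2 * (a (s + x) * a x)) UNIV"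
      by (rule infsum_add; rule summ[of s]; simp)
    also have "infsum (\<lambda>x. (a (s + x))\<^sup>2 + (a x)\<^sup>2) UNIV = G + G"
      by (subst infsum_add, (rule summ[of s]; simp)+, simp add: Ga Ga')
    finally show ?thesis by (simp only: infsum_cmult_right')
  qed
  have "\<bar>infsum (\<lambda>x. markov g x * g x) UNIV\<bar> \<le> infsum (\<lambda>x. markov a x * a x) UNIV"
  proof -
    have fm: "finite {x. markov f x * f x \<noteq> 0}" if "finite {x. f x \<noteq> 0}" for f
      by (rule finite_subset[OF _ that]) auto
    have "infsum (\<lambda>x. markov g x * g x) UNIV \<le> infsum (\<lambda>x. markov a x * a x) UNIV \<and>
       infsum (\<lambda>x. - (markov g x * g x)) UNIV \<le> infsum (\<lambda>x. markov a x * a x) UNIV"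
    proof -
      have "\<bar>markov g x\<bar> \<le> markov a x" for x
        unfolding markov_def a_def
        by (rule order_trans[OF sum_abs]) (auto intro!: sum_mono simp: abs_mult p_nonneg)
      then have le: "\<bar>markov g x * g x\<bar> \<le> markov a x * a x" for x
        by (simp add: abs_mult a_def mult_right_mono)
      show ?thesis
        using fm[OF g] fm[OF a] le
        by (auto intro!: infsum_mono finite_support_summable simp: abs_le_iff)
    qed
    then show ?thesis unfolding infsum_uminus by (blast intro: abs_leI)
  qed
  also have "\<dots> = (\<Sum>s\<in>S. p s * (G - D s / 2))"
    unfolding infsum_markov[OF a] D by (simp add: diff_divide_distrib)
  also have "\<dots> = G - (\<Sum>s\<in>S. p s * D s) / 2"
    by (simp add: right_diff_distrib sum_subtractf sum_p sum_divide_distrib flip: sum_distrib_right)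
  also have "\<dots> \<le> G - c * (\<kappa> * G) / 2"
  proof -
    have "c * (\<kappa> * G) \<le> c * (\<Sum>s\<in>S. D s)"
      using mult_left_mono[OF \<kappa>[OF a] c(1)] by (simp add: Ga D_def)
    also have "\<dots> = (\<Sum>s\<in>S. c * D s)"
      by (rule sum_distrib_left)
    also have "\<dots> \<le> (\<Sum>s\<in>S. p s * D s)"
      by (intro sum_mono mult_right_mono c) (auto simp: D_def intro: infsum_nonneg)
    finally show ?thesis by simp
  qed
  finally show ?thesis
    by (simp add: G_def left_diff_distrib)
qed

text \<open>Polarization turns the bound on the quadratic form into one on the operator norm.\<close>

lemma markov_norm_bound:
  assumes \<rho>: "\<rho> > 0"
    and quad: "\<And>g. finite {x. g x \<noteq> 0} \<Longrightarrow>
       \<bar>infsum (\<lambda>x. markov g x * g x) UNIV\<bar> \<le> \<rho> * infsum (\<lambda>x. (g x)\<^sup>2) UNIV"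
    and g: "finite {x. g x \<noteq> 0}"
  shows "infsum (\<lambda>x. (markov g x)\<^sup>2) UNIV \<le> \<rho>\<^sup>2 * infsum (\<lambda>x. (g x)\<^sup>2) UNIV"
proof -
  \<comment> \<open>The polarization uses \<open>g + h\<close> and \<open>g - h\<close>. This
    scaling turns the mixed form into \<open>N / \<rho>\<close>, with half of it recovered from the
    norm of \<open>h\<close> on the other side.\<close>
  define h where "h x = 1 / \<rho> * markov g x" for x
  define G where "G = infsum (\<lambda>x. (g x)\<^sup>2) UNIV"
  define N where "N = infsum (\<lambda>x. (markov g x)\<^sup>2) UNIV"
  have h: "finite {x. h x \<noteq> 0}"
    using finite_support_markov[OF g] \<rho> by (simp add: h_def)
  have fin: "finite {x. F x \<noteq> 0}" if "\<And>x. g x = 0 \<Longrightarrow> h x = 0 \<Longrightarrow> F x = 0" for F :: "'a \<Rightarrow> real"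
    using that by (intro finite_subset[OF _ finite_UnI[OF g h]]) auto
  have mk: "markov (\<lambda>x. g x + t * h x) x = markov g x + t * markov h x" for t x
    by (simp add: markov_def sum.distrib sum_distrib_left algebra_simps)
  have add: "infsum (\<lambda>x. F x + F' x) UNIV = infsum F UNIV + infsum F' UNIV"
    if "\<And>x. g x = 0 \<Longrightarrow> h x = 0 \<Longrightarrow> F x = 0" "\<And>x. g x = 0 \<Longrightarrow> h x = 0 \<Longrightarrow> F' x = 0" for F F' :: "'a \<Rightarrow> real"
    by (rule infsum_add; rule finite_support_summable; rule fin; use that in blast)
  have expand: "infsum (\<lambda>x. markov (\<lambda>x. g x + t * h x) x * (g x + t * h x)) UNIV =
      infsum (\<lambda>x. markov g x * g x) UNIV + 2 * t * infsum (\<lambda>x. markov g x * h x) UNIV +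
      t\<^sup>2 * infsum (\<lambda>x. markov h x * h x) UNIV" for t
  proof -
    have "infsum (\<lambda>x. markov (\<lambda>x. g x + t * h x) x * (g x + t * h x)) UNIV =
      infsum (\<lambda>x. ((markov g x * g x + t * (markov g x * h x)) + t * (g x * markov h x)) + t\<^sup>2 * (markov h x * h x)) UNIV"
      unfolding mk by (simp add: algebra_simps power2_eq_square)
    also have "\<dots> = infsum (\<lambda>x. markov g x * g x) UNIV + t * infsum (\<lambda>x. markov g x * h x) UNIV
        + t * infsum (\<lambda>x. g x * markov h x) UNIV + t\<^sup>2 * infsum (\<lambda>x. markov h x * h x) UNIV"
      by (subst add, simp, simp)+ (simp only: infsum_cmult_right')
    finally show ?thesis using markov_symmetric[OF g h] by simp
  qed
  have norm: "infsum (\<lambda>x. (g x + t * h x)\<^sup>2) UNIV =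
      G + 2 * t * infsum (\<lambda>x. g x * h x) UNIV + t\<^sup>2 * infsum (\<lambda>x. (h x)\<^sup>2) UNIV" for t
  proof -
    have "infsum (\<lambda>x. (g x + t * h x)\<^sup>2) UNIV = infsum (\<lambda>x. ((g x)\<^sup>2 + (2 * t) * (g x * h x)) + t\<^sup>2 * (h x)\<^sup>2) UNIV"
      by (simp add: power2_sum power_mult_distrib mult_ac add_ac)
    also have "\<dots> = G + (2 * t) * infsum (\<lambda>x. g x * h x) UNIV + t\<^sup>2 * infsum (\<lambda>x. (h x)\<^sup>2) UNIV"
      unfolding G_def by (subst add, simp, simp)+ (simp only: infsum_cmult_right')
    finally show ?thesis .
  qed
  have q: "\<bar>infsum (\<lambda>x. markov (\<lambda>x. g x + t * h x) x * (g x + t * h x)) UNIV\<bar>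
      \<le> \<rho> * infsum (\<lambda>x. (g x + t * h x)\<^sup>2) UNIV" for t
    by (rule quad, rule fin) simp
  have "4 * infsum (\<lambda>x. markov g x * h x) UNIV \<le> \<rho> * (2 * G + 2 * infsum (\<lambda>x. (h x)\<^sup>2) UNIV)"
    using add_mono[OF abs_le_D1[OF q[of 1]] abs_le_D2[OF q[of "- 1"]]] unfolding expand norm
    by (simp add: distrib_left right_diff_distrib mult_ac)
  moreover have "infsum (\<lambda>x. markov g x * h x) UNIV = N / \<rho>"
    using infsum_cmult_right'[of "1 / \<rho>" "\<lambda>x. (markov g x)\<^sup>2" UNIV]
    by (simp add: N_def h_def power2_eq_square)
  moreover have "infsum (\<lambda>x. (h x)\<^sup>2) UNIV = N / \<rho>\<^sup>2"
    using infsum_cmult_right'[of "1 / \<rho>\<^sup>2" "\<lambda>x. (markov g x)\<^sup>2" UNIV]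
    by (simp add: N_def h_def power_divide)
  ultimately have "4 * (N / \<rho>) \<le> \<rho> * (2 * G + 2 * (N / \<rho>\<^sup>2))"
    by simp
  also have "\<dots> = 2 * (\<rho> * G) + 2 * (N / \<rho>)"
    using \<rho> by (simp add: field_simps power2_eq_square)
  finally have "N / \<rho> \<le> \<rho> * G"
    by simp
  then show ?thesis
    using \<rho> by (simp add: N_def G_def field_simps power2_eq_square)
qed

text \<open>The law \<open>u n\<close> is the \<open>n\<close>-th iterate of \<open>markov\<close>
  on the point mass at \<open>0\<close>, so its l2 norm is at most \<open>\<rho> ^ n\<close>, and a
  single value is bounded by that norm.\<close>

lemma return_probability_bound:
  assumes \<rho>: "\<rho> \<ge> 0"
    and norm: "\<And>g. finite {x. g x \<noteq> 0} \<Longrightarrow>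
       infsum (\<lambda>x. (markov g x)\<^sup>2) UNIV \<le> \<rho>\<^sup>2 * infsum (\<lambda>x. (g x)\<^sup>2) UNIV"
  shows "E n (\<lambda>w. of_bool (sum_list w = z)) \<le> \<rho> ^ n"
proof -
  define u where "u n z = E n (\<lambda>w. of_bool (sum_list w = z))" for n z
  have step: "u (Suc n) = markov (u n)" for n
  proof
    fix z
    have "a + y = z \<longleftrightarrow> y = - a + z" for a y z :: 'a
      by (metis add.assoc add_0_left left_minus right_minus)
    then have "u (Suc n) z = (\<Sum>a\<in>S. p a * u n (- a + z))"
      by (simp add: u_def)
    also have "\<dots> = (\<Sum>a\<in>S. p (- a) * u n (- a + z))"
      by (simp add: p_uminus)
    also have "\<dots> = markov (u n) z"
      unfolding markov_def by (rule sum_uminus_S[of "\<lambda>a. p a * u n (a + z)"])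
    finally show "u (Suc n) z = markov (u n) z" .
  qed
  have u0: "{x. u 0 x \<noteq> 0} \<subseteq> {0}" by (auto simp: u_def)
  have fin: "finite {x. u n x \<noteq> 0}" for n
  proof (induction n)
    case 0
    show ?case by (rule finite_subset[OF u0]) simp
  next
    case (Suc n)
    show ?case unfolding step by (rule finite_support_markov[OF Suc])
  qed
  have "infsum (\<lambda>x. (u n x)\<^sup>2) UNIV \<le> (\<rho>\<^sup>2) ^ n"
  proof (induction n)
    case 0
    have "infsum (\<lambda>x. (u 0 x)\<^sup>2) UNIV = infsum (\<lambda>x. (u 0 x)\<^sup>2) {0}"
      by (rule infsum_cong_neutral) (use u0 in auto)
    then show ?case by (simp add: u_def)
  next
    case (Suc n)
    then show ?case
      using norm[OF fin[of n]] mult_left_mono[OF Suc, of "\<rho>\<^sup>2"] by (simp add: step)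
  qed
  moreover have "(u n z)\<^sup>2 \<le> infsum (\<lambda>x. (u n x)\<^sup>2) UNIV"
  proof -
    have "(\<lambda>x. (u n x)\<^sup>2) summable_on UNIV"
      using fin by (intro finite_support_summable) simp
    then have "infsum (\<lambda>x. (u n x)\<^sup>2) {z} \<le> infsum (\<lambda>x. (u n x)\<^sup>2) UNIV"
      by (intro infsum_mono_neutral) auto
    then show ?thesis by simp
  qed
  ultimately have "(u n z)\<^sup>2 \<le> (\<rho> ^ n)\<^sup>2"
    using power_even_eq[of \<rho> n] power_mult[of \<rho> 2 n] by simp
  then have "u n z \<le> \<rho> ^ n"
    by (rule power2_le_imp_le) (use \<rho> in simp)
  then show ?thesis unfolding u_def .
qed

end

theorem nonamenable_return_probability:
  fixes S :: "'a::group_add set"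
  assumes "\<not> amenable TYPE('a)" "finite S" "generates S" "S \<noteq> {}" "c > 0"
  obtains \<rho> where "0 < \<rho>" "\<rho> < 1"
    "\<And>p n z. symmetric_weights S p \<Longrightarrow> (\<And>s. s \<in> S \<Longrightarrow> c \<le> p s) \<Longrightarrow>
       word_expectation S p n (\<lambda>w. of_bool (sum_list w = z)) \<le> \<rho> ^ n"
proof -
  obtain \<kappa> where \<kappa>: "\<kappa> > 0" "\<And>g :: 'a \<Rightarrow> real. finite {x. g x \<noteq> 0} \<Longrightarrow>
     \<kappa> * infsum (\<lambda>x. (g x)\<^sup>2) UNIV \<le> (\<Sum>s\<in>S. infsum (\<lambda>x. (g (s + x) - g x)\<^sup>2) UNIV)"
    using nonamenable_Dirichlet_inequality[OF assms(1-4)] by blast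
  \<comment> \<open>The \<open>1 / 2\<close> keeps \<open>\<rho>\<close> positive, as the
    polarization divides by it. Since \<open>\<kappa>\<close> comes from \<open>S\<close> alone,
    \<open>\<rho>\<close> serves all weights bounded below by \<open>c\<close>.\<close>
  define \<rho> where "\<rho> = max (1 / 2) (1 - c * \<kappa> / 2)"
  have \<rho>: "0 < \<rho>" "\<rho> < 1" using \<kappa>(1) \<open>c > 0\<close> by (auto simp: \<rho>_def)
  show thesis
  proof (rule that[OF \<rho>])
    fix p n and z :: 'a assume "symmetric_weights S p" and c: "\<And>s. s \<in> S \<Longrightarrow> c \<le> p s"
    then interpret symmetric_weights S p by simp
    have "\<bar>infsum (\<lambda>x. markov g x * g x) UNIV\<bar> \<le> \<rho> * infsum (\<lambda>x. (g x)\<^sup>2) UNIV"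
      if "finite {x. g x \<noteq> 0}" for g
    proof -
      have "0 \<le> infsum (\<lambda>x. (g x)\<^sup>2) UNIV" by (rule infsum_nonneg) simp
      then have "(1 - c * \<kappa> / 2) * infsum (\<lambda>x. (g x)\<^sup>2) UNIV \<le> \<rho> * infsum (\<lambda>x. (g x)\<^sup>2) UNIV"
        by (intro mult_right_mono) (auto simp: \<rho>_def)
      then show ?thesis
        using markov_quadratic_form_bound[OF _ c \<kappa>(2) that] \<open>c > 0\<close> by force
    qed
    from return_probability_bound[OF _ markov_norm_bound[OF \<rho>(1) this]]
    show "E n (\<lambda>w. of_bool (sum_list w = z)) \<le> \<rho> ^ n"
      using \<rho> by simp
  qed
qed

section \<open>Gromov products along the walk\<close>

text \<open>Splitting the chain in the middle costs one \<open>\<tau>\<close> per level, so the loss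
  is the binary logarithm of the length instead of the length.\<close>

lemma chain_halving:
  fixes G :: "nat \<Rightarrow> nat \<Rightarrow> real"
  assumes G: "\<And>i j k. min (G i j) (G j k) - \<tau> \<le> G i k" and \<tau>: "0 \<le> \<tau>"
    and step: "\<And>j. a \<le> j \<Longrightarrow> j < b \<Longrightarrow> c \<le> G j (Suc j)"
    and ab: "a < b" "b - a \<le> 2 ^ k"
  shows "c - real k * \<tau> \<le> G a b"
  using step ab
proof (induction k arbitrary: a b)
  case 0
  then have "b = Suc a" by simp
  then show ?case using 0(1)[of a] by simp
next
  case (Suc k)
  show ?case
  proof (cases "b - a \<le> 2 ^ k")
    case True
    then have "c - real k * \<tau> \<le> G a b" by (intro Suc.IH Suc.prems)
    then show ?thesis using \<tau> by (simp add: algebra_simps)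
  next
    case False
    define m where "m = a + 2 ^ k"
    have m: "a < m" "m < b" "m - a \<le> 2 ^ k" "b - m \<le> 2 ^ k"
      using False Suc.prems by (auto simp: m_def)
    have "c - real k * \<tau> \<le> G a m" "c - real k * \<tau> \<le> G m b"
      using m by (intro Suc.IH Suc.prems(1); simp)+
    then show ?thesis using G[of a m b] by (simp add: algebra_simps)
  qed
qed

text \<open>
  The blocks \<open>[2\<^sup>k - 1, 2\<^sup>k\<^sup>+\<^sup>1 - 1]\<close> are chained one after the other, so that the loss at the
  \<open>j\<close>-th step is logarithmic in \<open>j\<close>, whatever the length of the chain is.
\<close>

lemma chain_logarithmic_loss:
  fixes G :: "nat \<Rightarrow> nat \<Rightarrow> real"
  assumes G: "\<And>i j k. min (G i j) (G j k) - \<tau> \<le> G i k" and \<tau>: "0 \<le> \<tau>"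
    and "m > 0"
    and step: "\<And>j. j < m \<Longrightarrow> c + 2 * \<tau> * log 2 (real j + 1) \<le> G j (Suc j)"
  shows "c - \<tau> \<le> G 0 m"
proof -
  have step': "c + 2 * \<tau> * real k \<le> G j (Suc j)" if "2 ^ k - 1 \<le> j" "j < m" for j k :: nat
  proof -
    have "(2::nat) ^ k \<le> j + 1" using that by linarith
    then have "real (2 ^ k) \<le> real (j + 1)" by (simp only: of_nat_le_iff)
    then have "(2::real) ^ k \<le> real j + 1" by simp
    then have "real k \<le> log 2 (real j + 1)" by (simp add: le_log_iff powr_realpow)
    then have "2 * \<tau> * real k \<le> 2 * \<tau> * log 2 (real j + 1)"
      using \<tau> by (intro mult_left_mono) auto
    then show ?thesis using step[OF that(2)] by simp
  qed
  \<comment> \<open>On block \<open>k\<close> each step exceeds \<open>c\<close> by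
    \<open>2 * \<tau> * k\<close>; halving spends one half of this, and the other half pays for
    joining the blocks.\<close>
  have block: "c + \<tau> * real k \<le> G (2 ^ k - 1) b" if "2 ^ k - 1 < b" "b \<le> m" "b \<le> 2 ^ Suc k - 1" for k b :: nat
  proof -
    have "c + 2 * \<tau> * real k - real k * \<tau> \<le> G (2 ^ k - 1) b"
    proof (rule chain_halving[OF G \<tau>])
      show "c + 2 * \<tau> * real k \<le> G j (Suc j)" if "2 ^ k - 1 \<le> j" "j < b" for j
        using step'[of k j] that \<open>b \<le> m\<close> by simp
      have "b - (2 ^ k - 1) \<le> (2 ^ Suc k - 1) - (2 ^ k - (1::nat))"
        using that(3) by (rule diff_le_mono)
      then show "b - (2 ^ k - 1) \<le> 2 ^ k" by simp
    qed (use that in auto)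
    then show ?thesis by (simp add: algebra_simps)
  qed
  \<comment> \<open>Induction from the end of the chain: block \<open>k\<close> and the tail
    starting at block \<open>k + 1\<close> both have value at least \<open>c + \<tau> * k\<close>,
    and joining them costs one \<open>\<tau>\<close>. At \<open>k = 0\<close> this is the
    claim.\<close>
  have "c + \<tau> * (real k - 1) \<le> G (2 ^ k - 1) m" if "2 ^ k - 1 < m" for k :: nat
    using that
  proof (induction "m - k" arbitrary: k rule: less_induct)
    case less
    show ?case
    proof (cases "m \<le> 2 ^ Suc k - 1")
      case True
      have "c + \<tau> * (real k - 1) \<le> c + \<tau> * real k"
        using \<tau> by (intro add_left_mono mult_left_mono) auto
      also have "\<dots> \<le> G (2 ^ k - 1) m"
        by (rule block) (use True less.prems in auto)
      finally show ?thesis .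
    next
      case False
      have "k < 2 ^ k" by simp
      then have "k \<le> 2 ^ k - 1" by linarith
      then have "m - Suc k < m - k" using less.prems by linarith
      then have "c + \<tau> * real k \<le> G (2 ^ Suc k - 1) m"
        using less.hyps[of "Suc k"] False by (simp only: not_le of_nat_Suc) simp
      moreover have "c + \<tau> * real k \<le> G (2 ^ k - 1) (2 ^ Suc k - 1)"
      proof (rule block)
        show "(2::nat) ^ k - 1 < 2 ^ Suc k - 1" by (rule diff_less_mono) auto
      qed (use False in auto)
      ultimately show ?thesis
        using G[of "2 ^ k - 1" "2 ^ Suc k - 1" m] by (simp only: min_def right_diff_distrib) (simp split: if_splits)
    qed
  qed
  from this[of 0] show ?thesis using \<open>m > 0\<close> by simp
qed

text \<open>\<open>four_point\<close> is the Gromov product inequality with base point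
  \<open>e\<close>, multiplied by 2 and rearranged so that no base point is distinguished.
  \<open>B\<close> is an exponential growth rate of balls.\<close>

locale left_invariant_hyperbolic_metric =
  fixes d :: "'a::group_add \<Rightarrow> 'a \<Rightarrow> real" and \<tau> B :: real
  assumes nonneg: "0 \<le> d x y" and refl [simp]: "d x x = 0" and commute: "d x y = d y x"
    and triangle: "d x z \<le> d x y + d y z"
    and invariant [simp]: "d (g + x) (g + y) = d x y"
    and \<tau>_nonneg: "0 \<le> \<tau>"
    and four_point: "d a b + d c e \<le> max (d a c + d b e) (d a e + d b c) + 2 * \<tau>"
    and B_nonneg: "0 \<le> B"
    and finite_ball: "finite {y. d 0 y \<le> R}"
    and ball_growth: "0 \<le> R \<Longrightarrow> real (card {y. d 0 y \<le> R}) \<le> exp (B * (R + 1))"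
begin

abbreviation gp :: "'a \<Rightarrow> 'a \<Rightarrow> real" where "gp \<equiv> gromov_product d 0"

lemma gp_commute: "gp x y = gp y x"
  by (simp add: gromov_product_def commute[of x y])

lemma gp_nonneg: "0 \<le> gp x y"
  using triangle[of x y 0] commute[of 0 y] by (simp add: gromov_product_def)

text \<open>The defect of additivity of the length is a Gromov product; through this identity
  bounded expected Gromov products make the mean length almost additive.\<close>

lemma dist_0_plus: "d 0 (x + y) = d 0 x + d 0 y - 2 * gp (- x) y"
proof -
  have "d 0 (x + y) = d (- x) y"
    using invariant[of "- x" 0 "x + y"] by (simp add: add.assoc[symmetric])
  moreover have "d (- x) 0 = d 0 x"
    using invariant[of "x" "- x" 0] by simp
  ultimately show ?thesis by (simp add: gromov_product_def commute[of y 0] field_simps)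
qed

lemma dist_triangle_abs: "\<bar>d a x - d a y\<bar> \<le> d x y"
  using triangle[of a x y] triangle[of a y x] commute[of x y] by (simp add: abs_le_iff)

text \<open>
  In a tree, \<open>virtual_dist x r z\<close> is the distance from \<open>z\<close> to the point at distance \<open>r\<close> from \<open>0\<close> on
  the geodesic from \<open>0\<close> to \<open>x\<close>. It stands in for geodesics, which \<open>d\<close> need not have.
\<close>

definition virtual_dist :: "'a \<Rightarrow> real \<Rightarrow> 'a \<Rightarrow> real" where
  "virtual_dist x r z = max (d 0 z - r) (d x z - d 0 x + r)"

lemma virtual_dist_lipschitz: "virtual_dist x r z \<le> virtual_dist x r z' + d z z'"
  using dist_triangle_abs[of 0 z z'] dist_triangle_abs[of x z z'] by (simp add: virtual_dist_def abs_le_iff max_def)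

lemma virtual_dist_ge: "r - d 0 z \<le> virtual_dist x r z"
  using triangle[of 0 x z] commute[of z x] by (simp add: virtual_dist_def max_def)

text \<open>Each of the two terms of \<open>virtual_dist\<close> is a distance, to \<open>0\<close>
  or to \<open>x\<close>, plus a constant, so each inherits \<open>four_point\<close>, and so does
  their maximum: the virtual point behaves like an extra point of the space.\<close>

lemma virtual_dist_four_point:
  "d a b + virtual_dist x r c \<le>
     max (virtual_dist x r b + d a c) (virtual_dist x r a + d c b) + 2 * \<tau>"
  using four_point[of a b 0 c] four_point[of a b x c] commute[of 0 a] commute[of 0 b] commute[of b c]
    commute[of x a] commute[of x b]
  by (simp add: virtual_dist_def max_def split: if_splits)

text \<open>\<open>four_point\<close> for \<open>a\<close>, \<open>b\<close>, \<open>0\<close>,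
  \<open>x\<close>: each sum on its right pairs a distance to \<open>0\<close>, at most
  \<open>R + r\<close>, with a distance to \<open>x\<close>, at most \<open>R + d 0 x - r\<close>,
  so the height \<open>r\<close> cancels. Hence the size of virtual balls is uniform in
  \<open>x\<close> and \<open>r\<close>.\<close>

lemma virtual_ball_diameter:
  assumes "virtual_dist x r a \<le> R" "virtual_dist x r b \<le> R"
  shows "d a b \<le> 2 * R + 2 * \<tau>"
  using four_point[of a b 0 x] assms commute[of 0 a] commute[of 0 b] commute[of a x] commute[of b x]
  by (simp add: virtual_dist_def max_def split: if_splits)

lemma virtual_ball:
  assumes R: "0 \<le> R"
  shows "finite {z. virtual_dist x r z \<le> R}"
    and "real (card {z. virtual_dist x r z \<le> R}) \<le> exp (B * (2 * R + 2 * \<tau> + 1))"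
proof -
  have sub: "finite {z. virtual_dist x r z \<le> R} \<and> card {z. virtual_dist x r z \<le> R} \<le> card {y. d 0 y \<le> 2 * R + 2 * \<tau>}"
  proof (cases "\<exists>a. virtual_dist x r a \<le> R")
    case True
    then obtain a where a: "virtual_dist x r a \<le> R" by blast
    have "{z. virtual_dist x r z \<le> R} \<subseteq> (+) a ` {y. d 0 y \<le> 2 * R + 2 * \<tau>}"
    proof
      fix z assume "z \<in> {z. virtual_dist x r z \<le> R}"
      then have "d a z \<le> 2 * R + 2 * \<tau>" using virtual_ball_diameter[OF a] by simp
      moreover have "d 0 (- a + z) = d a z" using invariant[of a 0 "- a + z"] by (simp add: add.assoc[symmetric])
      ultimately show "z \<in> (+) a ` {y. d 0 y \<le> 2 * R + 2 * \<tau>}"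
        by (intro image_eqI[of _ _ "- a + z"]) (auto simp: add.assoc[symmetric])
    qed
    then show ?thesis
      using finite_ball by (meson card_image_le card_mono finite_imageI finite_subset order_trans)
  qed simp
  then show "finite {z. virtual_dist x r z \<le> R}" by simp
  show "real (card {z. virtual_dist x r z \<le> R}) \<le> exp (B * (2 * R + 2 * \<tau> + 1))"
    using sub ball_growth[of "2 * R + 2 * \<tau>"] R \<tau>_nonneg by (simp add: add.assoc)
qed

text \<open>\<open>G i j\<close> is the Gromov product of two path points seen from the virtual
  point. It vanishes for the two ends, whereas a path avoiding the virtual point would have large
  consecutive products, and chaining would make the product of the ends positive. The second bound
  holds because after \<open>j\<close> steps the path is within \<open>D * j\<close> of
  \<open>0\<close>.\<close>

lemma path_near_virtual_point:
  assumes D: "\<And>j. j < m \<Longrightarrow> d (z j) (z (Suc j)) \<le> D" and z0: "z 0 = 0"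
    and r: "0 \<le> r" "r \<le> gp x (z m)" and "m > 0"
  shows "\<exists>j<m. virtual_dist x r (z j) < D + \<tau> + 1 + 2 * \<tau> * log 2 (real j + 1) \<and>
           r < D * real j + (D + \<tau> + 1 + 2 * \<tau> * log 2 (real j + 1))"
proof -
  define V where "V = virtual_dist x r"
  define G where "G i j = (V (z i) + V (z j) - d (z i) (z j)) / 2" for i j
  have G: "min (G i j) (G j k) - \<tau> \<le> G i k" for i j k
    using virtual_dist_four_point[of "z i" "z k" x r "z j"]
    unfolding G_def V_def[symmetric] by (auto simp: min_def max_def field_simps split: if_splits)
  \<comment> \<open>The condition \<open>r \<le> gp x (z m)\<close> says exactly that the first term
    of the maximum wins at \<open>z m\<close>.\<close>
  have "V (z m) = d 0 (z m) - r" "V (z 0) = r"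
    using r by (auto simp: V_def virtual_dist_def z0 gromov_product_def commute[of x 0] commute[of "z m" 0] max_def)
  then have G0: "G 0 m = 0"
    by (simp add: G_def z0)
  \<comment> \<open>The summand \<open>1\<close> is the margin that contradicts
    \<open>G 0 m = 0\<close> after the final loss of \<open>\<tau>\<close>.\<close>
  have "\<exists>j<m. G j (Suc j) < \<tau> + 1 + 2 * \<tau> * log 2 (real j + 1)"
  proof (rule ccontr)
    assume "\<not> ?thesis"
    then have "\<tau> + 1 + 2 * \<tau> * log 2 (real j + 1) \<le> G j (Suc j)" if "j < m" for j
      using that by (meson not_le)
    then have "\<tau> + 1 - \<tau> \<le> G 0 m"
      by (rule chain_logarithmic_loss[OF G \<tau>_nonneg \<open>m > 0\<close>])
    then show False using G0 by simp
  qed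
  then obtain j where j: "j < m" "G j (Suc j) < \<tau> + 1 + 2 * \<tau> * log 2 (real j + 1)" by blast
  have "V (z j) - d (z j) (z (Suc j)) \<le> G j (Suc j)"
    using virtual_dist_lipschitz[of x r "z j" "z (Suc j)"] by (simp add: G_def V_def field_simps)
  with j D[OF j(1)] have V: "V (z j) < D + \<tau> + 1 + 2 * \<tau> * log 2 (real j + 1)" by simp
  have "d 0 (z i) \<le> D * real i" if "i \<le> m" for i
    using that
  proof (induction i)
    case (Suc i)
    then show ?case using triangle[of 0 "z (Suc i)" "z i"] D[of i] by (simp add: algebra_simps)
  qed (simp add: z0)
  from this[of j] j(1) V virtual_dist_ge[of r "z j" x]
  show ?thesis unfolding V_def by (intro exI[of _ j]) auto
qed

end

section \<open>Uniform bound on the expected Gromov product\<close>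

lemma summable_powr_times_geometric:
  fixes \<rho> e :: real
  assumes "0 < \<rho>" "\<rho> < 1"
  shows "summable (\<lambda>j. (real j + 2) * (real j + 1) powr e * \<rho> ^ j)"
proof (rule summable_comparison_test_bigo)
  show "summable (\<lambda>j. norm (1 / real j ^ 2))"
    using inverse_power_summable[of 2, where 'a = real] by (simp add: inverse_eq_divide)
  show "(\<lambda>j. (real j + 2) * (real j + 1) powr e * \<rho> ^ j) \<in> O(\<lambda>j. 1 / real j ^ 2)"
    using assms by real_asymp
qed

lemma (in symmetric_weights) E_take:
  assumes "j \<le> m"
  shows "E m (\<lambda>w. F (take j w)) = E j F"
proof -
  have "E (j + (m - j)) (\<lambda>w. F (take j w)) = E j (\<lambda>u. E (m - j) (\<lambda>v. F u))"
    unfolding word_expectation_append by (rule word_expectation_cong) simp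
  then show ?thesis using assms by simp
qed

lemma (in symmetric_weights) E_of_bool_mem:
  assumes "finite A"
    and "\<And>z. E n (\<lambda>w. of_bool (sum_list w = z)) \<le> b"
  shows "E n (\<lambda>w. of_bool (sum_list w \<in> A)) \<le> real (card A) * b"
proof -
  have "of_bool (sum_list w \<in> A) = (\<Sum>z\<in>A. of_bool (sum_list w = z) :: real)" for w :: "'a list"
    using assms by (simp add: of_bool_def)
  then have "E n (\<lambda>w. of_bool (sum_list w \<in> A)) = (\<Sum>z\<in>A. E n (\<lambda>w. of_bool (sum_list w = z)))"
    by (simp add: word_expectation_sum)
  also have "\<dots> \<le> real (card A) * b"
    by (rule sum_bounded_above) (rule assms)
  finally show ?thesis .
qed

context left_invariant_hyperbolic_metric
begin

text \<open>Each integer height \<open>r\<close> up to the Gromov product is charged to a time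
  \<open>j\<close> at which the walk is in a virtual ball of radius \<open>R j\<close>. At time
  \<open>j\<close> only heights below \<open>L j\<close> occur, each with probability at most
  \<open>N j * \<rho> ^ j\<close>. As \<open>R j\<close> is logarithmic, \<open>N j\<close> is
  polynomial in \<open>j\<close> and the series converges.\<close>

lemma expected_gromov_product_bounded:
  assumes \<rho>: "0 < \<rho>" "\<rho> < 1" and D: "\<And>s. s \<in> S \<Longrightarrow> d 0 s \<le> D" "0 \<le> D"
  obtains C where "0 \<le> C"
    "\<And>p n x. symmetric_weights S p \<Longrightarrow>
       (\<And>n z. word_expectation S p n (\<lambda>w. of_bool (sum_list w = z)) \<le> \<rho> ^ n) \<Longrightarrow>
       word_expectation S p n (\<lambda>w. gp x (sum_list w)) \<le> C"
proof -
  define R where "R j = D + \<tau> + 1 + 2 * \<tau> * log 2 (real j + 1)" for j :: nat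
  define N where "N j = exp (B * (2 * R j + 2 * \<tau> + 1))" for j
  define L where "L j = nat \<lceil>D * real j + R j\<rceil>" for j
  have R: "0 \<le> R j" for j
    using D \<tau>_nonneg by (simp add: R_def)
  have L: "real (L j) \<le> D * real j + R j + 1" for j
    using R[of j] D by (simp add: L_def)
  \<comment> \<open>The logarithmic part of \<open>2 * B * R j\<close> is
    \<open>4 * B * \<tau> * log 2 (j + 1)\<close>; its exponential is the power \<open>e\<close> of
    \<open>j + 1\<close>.\<close>
  define e where "e = 4 * B * \<tau> / ln 2"
  define K where "K = (D + 2 * \<tau> + 2) * exp (B * (2 * (D + \<tau> + 1) + 2 * \<tau> + 1))"
  have le: "real (L j) * N j * \<rho> ^ j \<le> K * ((real j + 2) * (real j + 1) powr e * \<rho> ^ j)" for j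
  proof -
    have "real (j + 1) \<le> real (2 ^ j)"
      unfolding of_nat_le_iff by (induction j) auto
    then have "log 2 (real j + 1) \<le> real j"
      by (subst log_le_iff) (simp_all add: powr_realpow)
    then have "2 * \<tau> * log 2 (real j + 1) \<le> 2 * \<tau> * real j"
      using \<tau>_nonneg by (intro mult_left_mono) auto
    then have "real (L j) \<le> (D + 2 * \<tau> + 2) * (real j + 2)"
      using L[of j] D \<tau>_nonneg by (simp add: R_def algebra_simps)
    moreover have "N j = exp (B * (2 * (D + \<tau> + 1) + 2 * \<tau> + 1)) * (real j + 1) powr e"
      by (simp add: N_def R_def e_def log_def powr_def field_simps flip: exp_add)
    ultimately show ?thesis
      using \<rho> mult_right_mono[of "real (L j)" "(D + 2 * \<tau> + 2) * (real j + 2)" "N j * \<rho> ^ j"]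
      by (simp add: K_def mult_ac)
  qed
  have summ: "summable (\<lambda>j. real (L j) * N j * \<rho> ^ j)"
  proof (rule summable_comparison_test'[where N = 0])
    show "summable (\<lambda>j. K * ((real j + 2) * (real j + 1) powr e * \<rho> ^ j))"
      by (intro summable_mult summable_powr_times_geometric \<rho>)
    show "norm (real (L j) * N j * \<rho> ^ j) \<le> K * ((real j + 2) * (real j + 1) powr e * \<rho> ^ j)" for j
      using le[of j] \<rho> by (simp add: N_def abs_mult)
  qed
  define C where "C = (\<Sum>j. real (L j) * N j * \<rho> ^ j)"
  have C: "0 \<le> C" unfolding C_def using \<rho> by (intro suminf_nonneg summ) (auto simp: N_def)
  show thesis
  proof (rule that[OF C])
    fix p n and x :: 'a
    assume "symmetric_weights S p"
      and ret: "\<And>n z. word_expectation S p n (\<lambda>w. of_bool (sum_list w = z)) \<le> \<rho> ^ n"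
    then interpret symmetric_weights S p by simp
    define V where "V r j = {z. virtual_dist x (real r) z \<le> R j}" for r j :: nat
    have det: "gp x (sum_list w) \<le> (\<Sum>j<n. \<Sum>r<L j. of_bool (sum_list (take j w) \<in> V r j))"
      if w: "length w = n" "set w \<subseteq> S" for w
    proof (cases "n = 0")
      case False
      define k where "k = nat \<lfloor>gp x (sum_list w)\<rfloor>"
      have near: "\<exists>j<n. r < L j \<and> sum_list (take j w) \<in> V r j" if "r \<le> k" for r
      proof -
        have r: "real r \<le> gp x (sum_list (take n w))"
          using that w gp_nonneg[of x "sum_list w"] unfolding k_def by simp linarith
        have "\<exists>j<n. virtual_dist x (real r) (sum_list (take j w)) < R j \<and> real r < D * real j + R j"
          unfolding R_def
        proof (rule path_near_virtual_point[where z = "\<lambda>j. sum_list (take j w)", OF _ _ _ r])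
          fix j assume "j < n"
          then have "take (Suc j) w = take j w @ [w ! j]" "w ! j \<in> S"
            using w by (auto simp: take_Suc_conv_app_nth)
          then show "d (sum_list (take j w)) (sum_list (take (Suc j) w)) \<le> D"
            using D(1)[of "w ! j"] invariant[of "sum_list (take j w)" 0 "w ! j"] by simp
        qed (use False in auto)
        then obtain j where j: "j < n" "virtual_dist x (real r) (sum_list (take j w)) < R j" "real r < D * real j + R j"
          by blast
        have "r < L j" using j(3) unfolding L_def by linarith
        with j show ?thesis by (auto simp: V_def intro!: exI[of _ j])
      qed
      \<comment> \<open>Height \<open>0\<close> is counted too: the \<open>k + 1\<close> heights up
        to the integer part \<open>k\<close> exceed the product.\<close>
      have "gp x (sum_list w) \<le> real (card {..k})"
        unfolding k_def by (simp; linarith)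
      also have "\<dots> = (\<Sum>r\<le>k. 1)" by simp
      also have "\<dots> \<le> (\<Sum>r\<le>k. \<Sum>j<n. of_bool (r < L j \<and> sum_list (take j w) \<in> V r j))"
      proof (rule sum_mono)
        fix r assume "r \<in> {..k}"
        then obtain j where "j < n" "r < L j \<and> sum_list (take j w) \<in> V r j" using near by auto
        then show "1 \<le> (\<Sum>j<n. of_bool (r < L j \<and> sum_list (take j w) \<in> V r j) :: real)"
          using member_le_sum[of j "{..<n}" "\<lambda>j. of_bool (r < L j \<and> sum_list (take j w) \<in> V r j) :: real"] by simp
      qed
      also have "\<dots> = (\<Sum>j<n. \<Sum>r\<le>k. of_bool (r < L j \<and> sum_list (take j w) \<in> V r j))"
        by (rule sum.swap)
      also have "\<dots> \<le> (\<Sum>j<n. \<Sum>r<L j. of_bool (sum_list (take j w) \<in> V r j))"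
      proof (rule sum_mono)
        fix j
        have "(\<Sum>r\<le>k. of_bool (r < L j \<and> sum_list (take j w) \<in> V r j) :: real)
            = (\<Sum>r\<in>{..k} \<inter> {..<L j}. of_bool (sum_list (take j w) \<in> V r j))"
          by (rule sum.mono_neutral_cong_right) auto
        also have "\<dots> \<le> (\<Sum>r<L j. of_bool (sum_list (take j w) \<in> V r j))"
          by (rule sum_mono2) auto
        finally show "(\<Sum>r\<le>k. of_bool (r < L j \<and> sum_list (take j w) \<in> V r j) :: real)
            \<le> (\<Sum>r<L j. of_bool (sum_list (take j w) \<in> V r j))" .
      qed
      finally show ?thesis .
    next
      case True
      then show ?thesis using w by (simp add: gromov_product_def)
    qed
    have "E n (\<lambda>w. gp x (sum_list w)) \<le> E n (\<lambda>w. \<Sum>j<n. \<Sum>r<L j. of_bool (sum_list (take j w) \<in> V r j))"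
      by (rule E_mono) (rule det)
    also have "\<dots> = (\<Sum>j<n. \<Sum>r<L j. E j (\<lambda>w. of_bool (sum_list w \<in> V r j)))"
      unfolding word_expectation_sum
      by (intro sum.cong E_take[of _ n "\<lambda>u. of_bool (sum_list u \<in> V _ _)"] refl) simp_all
    also have "\<dots> \<le> (\<Sum>j<n. \<Sum>r<L j. N j * \<rho> ^ j)"
    proof (intro sum_mono)
      fix j r
      have "E j (\<lambda>w. of_bool (sum_list w \<in> V r j)) \<le> real (card (V r j)) * \<rho> ^ j"
        by (rule E_of_bool_mem[OF _ ret]) (simp add: V_def virtual_ball R)
      also have "\<dots> \<le> N j * \<rho> ^ j"
        using \<rho> virtual_ball(2)[OF R] by (intro mult_right_mono) (auto simp: V_def N_def)
      finally show "E j (\<lambda>w. of_bool (sum_list w \<in> V r j)) \<le> N j * \<rho> ^ j" .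
    qed
    also have "\<dots> = (\<Sum>j<n. real (L j) * N j * \<rho> ^ j)"
      by (simp add: mult.assoc)
    also have "\<dots> \<le> C"
      unfolding C_def using \<rho> by (intro sum_le_suminf summ) (auto simp: N_def)
    finally show "E n (\<lambda>w. gp x (sum_list w)) \<le> C" .
  qed
qed

end

section \<open>Quasi-additivity, variance and change of measure\<close>

text \<open>Averages at times \<open>m\<close> and \<open>n\<close> are compared through the common
  multiple \<open>m * n\<close>, which gives a Cauchy sequence. Taking the limit along the multiples
  of \<open>n\<close> keeps only the error \<open>h n\<close>.\<close>

lemma quasi_additive_limit:
  fixes b h :: "nat \<Rightarrow> real"
  assumes h: "h \<longlonglongrightarrow> 0"
    and b: "\<And>k n. 0 < k \<Longrightarrow> 0 < n \<Longrightarrow> \<bar>b (k * n) - real k * b n\<bar> \<le> real k * real n * h n"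
  obtains l where "(\<lambda>n. b n / real n) \<longlonglongrightarrow> l" "\<And>n. 0 < n \<Longrightarrow> \<bar>b n / real n - l\<bar> \<le> h n"
proof -
  define c where "c n = b n / real n" for n
  have c: "\<bar>c (k * n) - c n\<bar> \<le> h n" if "0 < k" "0 < n" for k n
  proof -
    have "c (k * n) - c n = (b (k * n) - real k * b n) / (real k * real n)"
      using that by (simp add: c_def field_simps)
    then have "\<bar>c (k * n) - c n\<bar> = \<bar>b (k * n) - real k * b n\<bar> / (real k * real n)"
      by (simp add: abs_mult)
    also have "\<dots> \<le> h n"
      using b[OF that] that by (simp add: divide_le_eq mult.commute)
    finally show ?thesis .
  qed
  have c2: "\<bar>c m - c n\<bar> \<le> h m + h n" if "0 < m" "0 < n" for m n
    using c[of m n] c[of n m] that by (simp add: mult.commute[of n m])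
  have "Cauchy c"
  proof (rule metric_CauchyI)
    fix e :: real assume "e > 0"
    then have "eventually (\<lambda>n. h n < e / 2) sequentially"
      using order_tendstoD(2)[OF h, of "e / 2"] by simp
    then obtain N where N: "\<And>n. n \<ge> N \<Longrightarrow> h n < e / 2"
      unfolding eventually_sequentially by blast
    have "dist (c m) (c n) < e" if "m \<ge> Suc N" "n \<ge> Suc N" for m n
      using c2[of m n] N[of m] N[of n] that by (simp add: dist_real_def)
    then show "\<exists>N. \<forall>m\<ge>N. \<forall>n\<ge>N. dist (c m) (c n) < e" by blast
  qed
  then obtain l where l: "c \<longlonglongrightarrow> l"
    using Cauchy_convergent convergent_def by blast
  have "\<bar>c n - l\<bar> \<le> h n" if "0 < n" for n
  proof (rule tendsto_upperbound)
    show "(\<lambda>k. \<bar>c n - c (Suc k * n)\<bar>) \<longlonglongrightarrow> \<bar>c n - l\<bar>"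
    proof (intro tendsto_intros LIMSEQ_subseq_LIMSEQ[OF l, unfolded o_def])
      show "strict_mono (\<lambda>k. Suc k * n)" using that by (simp add: strict_mono_def)
    qed
    show "\<forall>\<^sub>F k in sequentially. \<bar>c n - c (Suc k * n)\<bar> \<le> h n"
      using c[of "Suc _" n] that by (simp add: abs_minus_commute)
  qed simp
  with l show thesis using that unfolding c_def by blast
qed

text \<open>Doubling, rather than adding one block at a time, keeps the error linear in \<open>k\<close>.\<close>

lemma sqrt_quasi_additive:
  fixes b :: "nat \<Rightarrow> real"
  assumes b: "\<And>m n. \<bar>b (m + n) - b m - b n\<bar> \<le> K * (sqrt (real m) + sqrt (real n))"
    and K: "0 \<le> K" and k: "0 < k"
  shows "\<bar>b (k * n) - real k * b n\<bar> \<le> 5 * K * sqrt (real n) * (real k - sqrt (real k))"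
  using k
proof (induction k rule: less_induct)
  case (less k)
  show ?case
  \<comment> \<open>At \<open>k = 1\<close> both sides vanish; for larger \<open>k\<close> both
    halves are at least \<open>k / 3\<close>.\<close>
  proof (cases "k = 1")
    case False
    define i j where "i = k div 2" and "j = k - k div 2"
    have ij: "0 < i" "0 < j" "i < k" "j < k" "i + j = k" "k \<le> 3 * i" "k \<le> 3 * j"
      using False less.prems by (auto simp: i_def j_def)
    define x y z where "x = sqrt (real i)" and "y = sqrt (real j)" and "z = sqrt (real k)"
    have xy0: "0 \<le> x" "0 \<le> y" "0 \<le> z" by (simp_all add: x_def y_def z_def)
    have k': "real i + real j = real k" using ij(5) by linarith
    have "real k / 3 * (real k / 3) \<le> real i * real j"
      using ij by (intro mult_mono) auto
    then have "real k / 3 \<le> x * y"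
      unfolding x_def y_def real_sqrt_mult[symmetric] by (intro real_le_rsqrt) (simp add: power2_eq_square)
    \<comment> \<open>The square of \<open>x + y\<close> is at least \<open>5 / 3 * k\<close>, more
      than \<open>25 / 16 * k\<close>. The gain of \<open>x + y\<close> over \<open>z\<close> pays
      for the error of the splitting, which is why the induction carries the term
      \<open>- sqrt k\<close>.\<close>
    then have "(5 / 4 * z)\<^sup>2 \<le> (x + y)\<^sup>2"
      using k' unfolding power2_sum power_mult_distrib by (simp add: x_def y_def z_def power2_eq_square)
    then have z: "5 / 4 * z \<le> x + y"
      by (rule power2_le_imp_le) (use xy0 in auto)
    have "\<bar>b (k * n) - real k * b n\<bar> \<le> \<bar>b (i * n + j * n) - b (i * n) - b (j * n)\<bar>
        + \<bar>b (i * n) - real i * b n\<bar> + \<bar>b (j * n) - real j * b n\<bar>"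
      unfolding ij(5)[symmetric] by (simp add: algebra_simps)
    also have "\<dots> \<le> K * (sqrt (real (i * n)) + sqrt (real (j * n)))
        + 5 * K * sqrt (real n) * (real i - x) + 5 * K * sqrt (real n) * (real j - y)"
      using ij unfolding x_def y_def by (intro add_mono b less.IH)
    also have "\<dots> = K * sqrt (real n) * (5 * real k - 4 * (x + y))"
      by (simp add: real_sqrt_mult x_def[symmetric] y_def[symmetric] k'[symmetric] algebra_simps)
    also have "\<dots> \<le> K * sqrt (real n) * (5 * real k - 5 * z)"
      using K z by (intro mult_left_mono) auto
    finally show ?thesis
      by (simp add: z_def algebra_simps)
  qed simp
qed

section \<open>Second moments of additive functionals and of likelihood ratios\<close>

context symmetric_weights
begin

lemma E_additive_mean_zero:
  assumes "(\<Sum>a\<in>S. p a * \<nu> a) = 0"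
  shows "E n (\<lambda>w. \<Sum>a\<leftarrow>w. \<nu> a) = 0"
proof (induction n)
  case (Suc n)
  then show ?case using assms by (simp add: word_expectation_add)
qed simp

lemma E_additive_square:
  assumes "(\<Sum>a\<in>S. p a * \<nu> a) = 0"
  shows "E n (\<lambda>w. (\<Sum>a\<leftarrow>w. \<nu> a)\<^sup>2) = real n * (\<Sum>a\<in>S. p a * (\<nu> a)\<^sup>2)"
proof (induction n)
  case (Suc n)
  have "E n (\<lambda>w. (\<nu> b + (\<Sum>a\<leftarrow>w. \<nu> a))\<^sup>2) = (\<nu> b)\<^sup>2 + E n (\<lambda>w. (\<Sum>a\<leftarrow>w. \<nu> a)\<^sup>2)" for b
    unfolding power2_sum word_expectation_add mult.assoc word_expectation_cmult
    by (simp add: E_additive_mean_zero[OF assms])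
  then show ?case
    using Suc by (simp add: distrib_left sum.distrib) (simp add: sum_p distrib_right flip: sum_distrib_right)
qed simp

lemma E_abs_additive_le:
  assumes "(\<Sum>a\<in>S. p a * \<nu> a) = 0"
  shows "E n (\<lambda>w. \<bar>\<Sum>a\<leftarrow>w. \<nu> a\<bar>) \<le> sqrt (\<Sum>a\<in>S. p a * (\<nu> a)\<^sup>2) * sqrt (real n)"
  using E_Cauchy_Schwarz_sqrt[of n "\<lambda>w. \<bar>\<Sum>a\<leftarrow>w. \<nu> a\<bar>" "\<lambda>_. 1"]
  by (simp add: E_additive_square[OF assms] real_sqrt_mult mult.commute)

text \<open>The product expands into products of \<open>h\<close> over subsets of the letters,
  pairwise orthogonal because \<open>h\<close> is centred under \<open>p\<close>. Removing degrees 0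
  and 1 leaves a squared norm equal to the terms of degree at least 2 of the binomial
  \<open>(1 + v) ^ n\<close>.\<close>

lemma E_density_linearization:
  assumes h: "(\<Sum>a\<in>S. p a * h a) = 0"
  defines "v \<equiv> \<Sum>a\<in>S. p a * (h a)\<^sup>2"
  shows "E n (\<lambda>w. (\<Prod>a\<leftarrow>w. 1 + h a) - 1 - (\<Sum>a\<leftarrow>w. h a)) = 0"
    and "E n (\<lambda>w. ((\<Prod>a\<leftarrow>w. 1 + h a) - 1 - (\<Sum>a\<leftarrow>w. h a))\<^sup>2) = (1 + v) ^ n - 1 - real n * v"
proof -
  define L where "L w = (\<Prod>a\<leftarrow>w. 1 + h a)" for w :: "'a list"
  define M where "M w = (\<Sum>a\<leftarrow>w. h a)" for w :: "'a list"
  have L [simp]: "L [] = 1" "L (a # w) = (1 + h a) * L w" for a w by (simp_all add: L_def)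
  have M [simp]: "M [] = 0" "M (a # w) = h a + M w" for a w by (simp_all add: M_def)
  have ph: "(\<Sum>a\<in>S. p a * (1 + h a)) = 1" by (simp add: distrib_left sum.distrib sum_p h)
  have EL: "E n L = 1" for n
  proof (induction n)
    case (Suc n)
    then show ?case by (simp add: word_expectation_cmult ph)
  qed simp
  have EL2: "E n (\<lambda>w. (L w)\<^sup>2) = (1 + v) ^ n" for n
  proof (induction n)
    case (Suc n)
    have "(\<Sum>a\<in>S. p a * (1 + h a)\<^sup>2) = (\<Sum>a\<in>S. p a + 2 * (p a * h a) + p a * (h a)\<^sup>2)"
      by (intro sum.cong) (simp_all add: power2_eq_square algebra_simps)
    also have "\<dots> = 1 + v"
      by (simp add: sum.distrib sum_p h v_def flip: sum_distrib_left)
    finally have "(\<Sum>a\<in>S. p a * (1 + h a)\<^sup>2) = 1 + v" .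
    moreover have "E (Suc n) (\<lambda>w. (L w)\<^sup>2) = (\<Sum>a\<in>S. p a * (1 + h a)\<^sup>2) * (1 + v) ^ n"
      by (simp add: power_mult_distrib word_expectation_cmult Suc sum_distrib_right mult.assoc)
    ultimately show ?case by simp
  qed simp
  have EM: "E n M = 0" for n
    unfolding M_def by (rule E_additive_mean_zero[OF h])
  have EM2: "E n (\<lambda>w. (M w)\<^sup>2) = real n * v" for n
    unfolding M_def v_def by (rule E_additive_square[OF h])
  have ELM: "E n (\<lambda>w. L w * M w) = real n * v" for n
  proof (induction n)
    case (Suc n)
    have "E n (\<lambda>w. L (a # w) * M (a # w)) = (1 + h a) * (h a + real n * v)" for a
    proof -
      have "E n (\<lambda>w. L (a # w) * M (a # w)) = E n (\<lambda>w. (1 + h a) * (h a * L w + L w * M w))"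
        by (simp add: algebra_simps)
      also have "\<dots> = (1 + h a) * (h a + real n * v)"
        by (simp only: word_expectation_cmult word_expectation_add EL Suc) simp
      finally show ?thesis .
    qed
    then have "E (Suc n) (\<lambda>w. L w * M w) = (\<Sum>a\<in>S. p a * ((1 + h a) * (h a + real n * v)))"
      by simp
    also have "\<dots> = (\<Sum>a\<in>S. p a * h a + p a * (h a)\<^sup>2 + real n * v * (p a * (1 + h a)))"
      by (intro sum.cong) (simp_all add: power2_eq_square algebra_simps)
    also have "\<dots> = v + real n * v"
      by (simp only: sum.distrib h v_def flip: sum_distrib_left) (simp add: sum.distrib[symmetric] ph)
    finally show ?case by (simp add: algebra_simps)
  qed simp
  show "E n (\<lambda>w. (\<Prod>a\<leftarrow>w. 1 + h a) - 1 - (\<Sum>a\<leftarrow>w. h a)) = 0"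
    unfolding L_def[symmetric] M_def[symmetric] word_expectation_diff by (simp add: EL EM)
  have "E n (\<lambda>w. (L w - 1 - M w)\<^sup>2) =
      E n (\<lambda>w. (L w)\<^sup>2 + (M w)\<^sup>2 + 2 * M w + 1 - 2 * L w - 2 * (L w * M w))"
    by (simp add: power2_eq_square algebra_simps)
  also have "\<dots> = (1 + v) ^ n - 1 - real n * v"
    unfolding word_expectation_diff word_expectation_add word_expectation_cmult
    by (simp add: EL EL2 EM EM2 ELM)
  finally show "E n (\<lambda>w. ((\<Prod>a\<leftarrow>w. 1 + h a) - 1 - (\<Sum>a\<leftarrow>w. h a))\<^sup>2) = (1 + v) ^ n - 1 - real n * v"
    unfolding L_def M_def .
qed

end

lemma power_minus_linear_bound:
  fixes v :: real
  assumes "0 \<le> v" "real n * v \<le> 1"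
  shows "(1 + v) ^ n - 1 - real n * v \<le> (real n * v)\<^sup>2"
proof -
  have "(1 + v) ^ n \<le> exp v ^ n"
    using assms by (intro power_mono exp_ge_add_one_self) auto
  also have "\<dots> = exp (real n * v)" by (simp add: exp_of_nat_mult)
  also have "\<dots> \<le> 1 + real n * v + (real n * v)\<^sup>2"
    using assms by (intro exp_bound) auto
  finally show ?thesis by simp
qed

text \<open>\<open>C\<close> and \<open>D\<close> are parameters of the locale so that one pair can
  serve a whole family of weights.\<close>

locale escaping_walk = symmetric_weights S p + left_invariant_hyperbolic_metric d \<tau> B
  for S :: "'a::group_add set" and p and d :: "'a \<Rightarrow> 'a \<Rightarrow> real" and \<tau> B +
  fixes C D :: real
  assumes E_gp_le: "E n (\<lambda>w. gp x (sum_list w)) \<le> C"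
    and step_le: "s \<in> S \<Longrightarrow> d 0 s \<le> D"
    and D_nonneg: "0 \<le> D"
begin

abbreviation len :: "'a list \<Rightarrow> real" where "len w \<equiv> d 0 (sum_list w)"

lemma E_gp_nonneg: "0 \<le> E n (\<lambda>w. gp x (sum_list w))"
  by (intro E_nonneg gp_nonneg)

lemma C_nonneg: "0 \<le> C"
  using E_gp_nonneg E_gp_le order_trans by blast

lemma E_translated_length: "E n (\<lambda>w. d 0 (y + sum_list w)) = d 0 y + E n len - 2 * E n (\<lambda>w. gp (- y) (sum_list w))"
  unfolding dist_0_plus word_expectation_diff word_expectation_add word_expectation_cmult by simp

lemma E_length_add: "\<bar>E (m + n) len - E m len - E n len\<bar> \<le> 2 * C"
proof -
  have "E (m + n) len - E m len - E n len = - 2 * E m (\<lambda>u. E n (\<lambda>v. gp (- sum_list u) (sum_list v)))"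
    unfolding word_expectation_append sum_list_append E_translated_length
      word_expectation_diff word_expectation_add word_expectation_cmult by simp
  moreover have "E m (\<lambda>u. E n (\<lambda>v. gp (- sum_list u) (sum_list v))) \<le> C"
    using E_mono[of m "\<lambda>u. E n (\<lambda>v. gp (- sum_list u) (sum_list v))" "\<lambda>_. C"] E_gp_le by simp
  moreover have "0 \<le> E m (\<lambda>u. E n (\<lambda>v. gp (- sum_list u) (sum_list v)))"
    by (intro E_nonneg E_gp_nonneg)
  ultimately show ?thesis by simp
qed

text \<open>Adding one block of length \<open>n\<close> at a time costs \<open>2 * C\<close> per
  block, hence the relative error \<open>2 * C / n\<close>, which depends on the weights through
  \<open>C\<close> only.\<close>

lemma escape_rate:
  obtains l where "(\<lambda>n. E n len / real n) \<longlonglongrightarrow> l" "\<And>n. 0 < n \<Longrightarrow> \<bar>E n len / real n - l\<bar> \<le> 2 * C / real n"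
proof (rule quasi_additive_limit)
  show "(\<lambda>n. 2 * C / real n) \<longlonglongrightarrow> 0" by (rule lim_const_over_n)
  show "\<bar>E (k * n) len - real k * E n len\<bar> \<le> real k * real n * (2 * C / real n)" if "0 < k" "0 < n" for k n
  proof -
    have "\<bar>E (k * n) len - real k * E n len\<bar> \<le> real k * (2 * C)"
    proof (induction k)
      case (Suc k)
      have "\<bar>E (Suc k * n) len - real (Suc k) * E n len\<bar> \<le>
          \<bar>E (n + k * n) len - E n len - E (k * n) len\<bar> + \<bar>E (k * n) len - real k * E n len\<bar>"
        by (simp add: algebra_simps)
      also have "\<dots> \<le> real (Suc k) * (2 * C)"
        using add_mono[OF E_length_add Suc] by (simp add: algebra_simps)
      finally show ?case .
    qed simp
    then show ?thesis using that by simp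
  qed
qed (rule that)

text \<open>A martingale-difference estimate: \<open>f n y\<close> is the mean length after
  \<open>n\<close> further steps from \<open>y\<close>, and changing the step just taken alters it
  by at most \<open>2 * D\<close> through the start and \<open>2 * C\<close> through the Gromov
  products.\<close>

lemma E_length_variance:
  "E n (\<lambda>w. (len w - E n len)\<^sup>2) \<le> real n * (2 * C + 2 * D)\<^sup>2"
proof -
  define f where "f n y = E n (\<lambda>w. d 0 (y + sum_list w))" for n y
  have f_diff: "\<bar>f n (y + a) - f n (y + b)\<bar> \<le> 2 * C + 2 * D" if "a \<in> S" "b \<in> S" for n y a b
  proof -
    have "d (y + a) (y + b) \<le> 2 * D"
      using triangle[of a b 0] commute[of a 0] step_le[OF that(1)] step_le[OF that(2)] by simp
    then have "\<bar>d 0 (y + a) - d 0 (y + b)\<bar> \<le> 2 * D"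
      using dist_triangle_abs[of 0 "y + a" "y + b"] by simp
    then show ?thesis
      unfolding f_def E_translated_length
      using E_gp_le[of n "- (y + a)"] E_gp_le[of n "- (y + b)"] E_gp_nonneg[of n "- (y + a)"] E_gp_nonneg[of n "- (y + b)"]
      by (simp add: abs_le_iff)
  qed
  have "E n (\<lambda>w. (d 0 (y + sum_list w) - f n y)\<^sup>2) \<le> real n * (2 * C + 2 * D)\<^sup>2" for n y
  proof (induction n arbitrary: y)
    case (Suc n)
    have f_Suc: "f (Suc n) y = (\<Sum>b\<in>S. p b * f n (y + b))"
      by (simp add: f_def add.assoc)
    have "\<bar>f n (y + a) - f (Suc n) y\<bar> \<le> 2 * C + 2 * D" if "a \<in> S" for a
    proof -
      have "f n (y + a) - f (Suc n) y = (\<Sum>b\<in>S. p b * (f n (y + a) - f n (y + b)))"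
        unfolding f_Suc by (simp add: right_diff_distrib sum_subtractf sum_p flip: sum_distrib_right)
      also have "\<bar>\<dots>\<bar> \<le> (\<Sum>b\<in>S. p b * (2 * C + 2 * D))"
        by (rule order_trans[OF sum_abs]) (auto intro!: sum_mono mult_left_mono f_diff that simp: abs_mult p_nonneg)
      finally show ?thesis by (simp add: sum_p flip: sum_distrib_right)
    qed
    then have sq: "(f n (y + a) - f (Suc n) y)\<^sup>2 \<le> (2 * C + 2 * D)\<^sup>2" if "a \<in> S" for a
      using that by (meson abs_ge_zero order_trans abs_le_square_iff abs_ge_self)
    have "E n (\<lambda>w. (d 0 (y + (a + sum_list w)) - f (Suc n) y)\<^sup>2) \<le> real (Suc n) * (2 * C + 2 * D)\<^sup>2"
      if "a \<in> S" for a
    proof -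
      define m where "m = f n (y + a)"
      define c where "c = f (Suc n) y"
      define X where "X w = d 0 (y + a + sum_list w)" for w
      have "E n X = m" by (simp add: X_def[abs_def] m_def f_def)
      \<comment> \<open>Pythagoras: the cross term averages to 0 because \<open>m\<close> is the
        mean of \<open>X\<close>.\<close>
      have "E n (\<lambda>w. (X w - c)\<^sup>2) = E n (\<lambda>w. (X w - m)\<^sup>2 + 2 * (m - c) * (X w - m) + (m - c)\<^sup>2)"
        by (simp add: power2_eq_square algebra_simps)
      also have "\<dots> = E n (\<lambda>w. (X w - m)\<^sup>2) + (m - c)\<^sup>2"
        by (simp only: word_expectation_add word_expectation_cmult word_expectation_diff \<open>E n X = m\<close> E_const) simp
      also have "\<dots> \<le> real n * (2 * C + 2 * D)\<^sup>2 + (2 * C + 2 * D)\<^sup>2"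
        unfolding X_def m_def c_def by (intro add_mono Suc.IH sq that)
      finally show ?thesis
        by (simp add: X_def c_def algebra_simps)
    qed
    then have "E (Suc n) (\<lambda>w. (d 0 (y + sum_list w) - f (Suc n) y)\<^sup>2) \<le> (\<Sum>a\<in>S. p a * (real (Suc n) * (2 * C + 2 * D)\<^sup>2))"
      by (auto intro!: sum_mono mult_left_mono p_nonneg)
    then show ?case by (simp add: sum_p flip: sum_distrib_right)
  qed (simp add: f_def)
  from this[of n 0] show ?thesis by (simp add: f_def)
qed

text \<open>As \<open>F\<close> is centred, \<open>len\<close> may be replaced by its deviation from
  the mean, which has size \<open>sqrt n\<close> by the variance bound; Cauchy-Schwarz does the
  rest.\<close>

lemma E_length_covariance:
  assumes "E n F = 0"
  shows "\<bar>E n (\<lambda>w. len w * F w)\<bar> \<le> (2 * C + 2 * D) * sqrt (real n) * sqrt (E n (\<lambda>w. (F w)\<^sup>2))"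
proof -
  have "E n (\<lambda>w. len w * F w) = E n (\<lambda>w. (len w - E n len) * F w)"
    unfolding left_diff_distrib word_expectation_diff word_expectation_cmult by (simp add: assms)
  also have "\<bar>\<dots>\<bar> \<le> sqrt (E n (\<lambda>w. (len w - E n len)\<^sup>2)) * sqrt (E n (\<lambda>w. (F w)\<^sup>2))"
    by (rule E_Cauchy_Schwarz_sqrt)
  also have "\<dots> \<le> (2 * C + 2 * D) * sqrt (real n) * sqrt (E n (\<lambda>w. (F w)\<^sup>2))"
  proof (rule mult_right_mono)
    have "sqrt (E n (\<lambda>w. (len w - E n len)\<^sup>2)) \<le> sqrt (real n * (2 * C + 2 * D)\<^sup>2)"
      by (intro real_sqrt_le_mono E_length_variance)
    then show "sqrt (E n (\<lambda>w. (len w - E n len)\<^sup>2)) \<le> (2 * C + 2 * D) * sqrt (real n)"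
      using C_nonneg D_nonneg by (simp add: real_sqrt_mult mult.commute)
    show "0 \<le> sqrt (E n (\<lambda>w. (F w)\<^sup>2))"
      by (intro real_sqrt_ge_zero E_nonneg) simp
  qed
  finally show ?thesis .
qed

text \<open>In \<open>(len u + len v - 2 * g u v) * (M u + M v)\<close> the cross terms of a length
  and an \<open>M\<close> vanish by independence. In the defect, \<open>M u\<close> is constant
  while \<open>v\<close> is averaged and \<open>M v\<close> while \<open>u\<close> is averaged, so
  each time \<open>g\<close> contributes at most \<open>C\<close> and the mean of the absolute value
  of \<open>M\<close> is of order \<open>sqrt n\<close>.\<close>

lemma covariance_add:
  assumes \<nu>: "(\<Sum>a\<in>S. p a * \<nu> a) = 0"
  defines "b \<equiv> \<lambda>n. E n (\<lambda>w. len w * (\<Sum>a\<leftarrow>w. \<nu> a))"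
  shows "\<bar>b (m + n) - b m - b n\<bar> \<le>
    2 * C * sqrt (\<Sum>a\<in>S. p a * (\<nu> a)\<^sup>2) * (sqrt (real m) + sqrt (real n))"
proof -
  define s where "s = sqrt (\<Sum>a\<in>S. p a * (\<nu> a)\<^sup>2)"
  define M where "M w = (\<Sum>a\<leftarrow>w. \<nu> a)" for w :: "'a list"
  have M0: "E n M = 0" for n
    unfolding M_def by (rule E_additive_mean_zero[OF \<nu>])
  have Mabs: "E n (\<lambda>w. \<bar>M w\<bar>) \<le> s * sqrt (real n)" for n
    unfolding M_def s_def by (rule E_abs_additive_le[OF \<nu>])
  have b: "b n = E n (\<lambda>w. len w * M w)" for n
    by (simp only: b_def M_def)
  define g where "g u v = gp (- sum_list u) (sum_list v)" for u v :: "'a list"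
  have g0: "0 \<le> g u v" for u v by (simp add: g_def gp_nonneg)
  have g1: "E n (g u) \<le> C" for n u
    unfolding g_def by (rule E_gp_le)
  \<comment> \<open>Here the averaged variable enters through its inverse, so the symmetry of the
    walk is used.\<close>
  have g2: "E m (\<lambda>u. g u v) \<le> C" for m v
    using E_gp_le[of m "sum_list v"] E_inverse_walk[of m "\<lambda>z. gp z (sum_list v)"]
    by (simp add: g_def gp_commute)
  define X where "X = E m (\<lambda>u. E n (\<lambda>v. g u v * (M u + M v)))"
  have "b (m + n) = E m (\<lambda>u. E n (\<lambda>v. len u * M u + len u * M v + M u * len v + len v * M v - 2 * (g u v * (M u + M v))))"
    unfolding b word_expectation_append by (simp add: M_def dist_0_plus g_def algebra_simps)
  also have "\<dots> = b m + b n - 2 * X"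
  proof -
    have "E n (\<lambda>v. len u * M u + len u * M v + M u * len v + len v * M v - 2 * (g u v * (M u + M v)))
        = len u * M u + E n len * M u + b n - 2 * E n (\<lambda>v. g u v * (M u + M v))" for u
      unfolding word_expectation_add word_expectation_diff word_expectation_cmult
      by (simp add: M0 b mult.commute)
    then show ?thesis
      unfolding X_def word_expectation_add word_expectation_diff word_expectation_cmult
      by (simp add: word_expectation_add word_expectation_diff word_expectation_cmult M0 b
          mult.commute[of "M _" "E n len"])
  qed
  finally have "b (m + n) - b m - b n = - 2 * X" by simp
  moreover have "\<bar>X\<bar> \<le> C * s * (sqrt (real m) + sqrt (real n))"
  proof -
    have "\<bar>X\<bar> \<le> E m (\<lambda>u. \<bar>E n (\<lambda>v. g u v * (M u + M v))\<bar>)"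
      unfolding X_def by (rule E_abs)
    also have "\<dots> \<le> E m (\<lambda>u. E n (\<lambda>v. \<bar>M u\<bar> * g u v + \<bar>M v\<bar> * g u v))"
    proof (rule E_mono)
      fix u
      have "\<bar>E n (\<lambda>v. g u v * (M u + M v))\<bar> \<le> E n (\<lambda>v. \<bar>g u v * (M u + M v)\<bar>)"
        by (rule E_abs)
      also have "\<dots> \<le> E n (\<lambda>v. \<bar>M u\<bar> * g u v + \<bar>M v\<bar> * g u v)"
      proof (rule E_mono)
        fix v
        have "\<bar>g u v * (M u + M v)\<bar> = g u v * \<bar>M u + M v\<bar>" by (simp add: abs_mult g0)
        also have "\<dots> \<le> g u v * (\<bar>M u\<bar> + \<bar>M v\<bar>)" by (intro mult_left_mono abs_triangle_ineq g0)
        finally show "\<bar>g u v * (M u + M v)\<bar> \<le> \<bar>M u\<bar> * g u v + \<bar>M v\<bar> * g u v" by (simp add: algebra_simps)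
      qed
      finally show "\<bar>E n (\<lambda>v. g u v * (M u + M v))\<bar> \<le> E n (\<lambda>v. \<bar>M u\<bar> * g u v + \<bar>M v\<bar> * g u v)" .
    qed
    also have "\<dots> = E m (\<lambda>u. \<bar>M u\<bar> * E n (g u)) + E n (\<lambda>v. \<bar>M v\<bar> * E m (\<lambda>u. g u v))"
      unfolding word_expectation_add
      by (subst (2) word_expectation_swap) (simp only: word_expectation_cmult)
    also have "\<dots> \<le> E m (\<lambda>u. C * \<bar>M u\<bar>) + E n (\<lambda>v. C * \<bar>M v\<bar>)"
      by (intro add_mono E_mono) (simp_all add: mult.commute[of C] mult_left_mono g1 g2)
    also have "\<dots> \<le> C * (s * sqrt (real m)) + C * (s * sqrt (real n))"
      unfolding word_expectation_cmult by (intro add_mono mult_left_mono Mabs C_nonneg)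
    finally show ?thesis by (simp add: algebra_simps)
  qed
  ultimately show ?thesis unfolding s_def by simp
qed

lemma covariance_convergent:
  assumes \<nu>: "(\<Sum>a\<in>S. p a * \<nu> a) = 0"
  shows "convergent (\<lambda>n. E n (\<lambda>w. len w * (\<Sum>a\<leftarrow>w. \<nu> a)) / real n)"
proof -
  define b where "b n = E n (\<lambda>w. len w * (\<Sum>a\<leftarrow>w. \<nu> a))" for n
  define K where "K = 2 * C * sqrt (\<Sum>a\<in>S. p a * (\<nu> a)\<^sup>2)"
  have K: "0 \<le> K" using C_nonneg p_nonneg by (simp add: K_def sum_nonneg)
  have bound: "\<bar>b (k * n) - real k * b n\<bar> \<le> real k * real n * (5 * K * sqrt (real n) / real n)"
    if "0 < k" "0 < n" for k n
  proof -
    have "\<bar>b (k * n) - real k * b n\<bar> \<le> 5 * K * sqrt (real n) * (real k - sqrt (real k))"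
      using covariance_add[OF \<nu>] K that(1) unfolding K_def b_def by (intro sqrt_quasi_additive)
    also have "\<dots> \<le> 5 * K * sqrt (real n) * real k"
      using K by (intro mult_left_mono) auto
    finally show ?thesis using that by (simp add: mult_ac)
  qed
  have "(\<lambda>n. 5 * K * (sqrt (real n) / real n)) \<longlonglongrightarrow> 0"
    by (intro tendsto_mult_right_zero) real_asymp
  then have lim: "(\<lambda>n. 5 * K * sqrt (real n) / real n) \<longlonglongrightarrow> 0"
    by simp
  obtain l where "(\<lambda>n. b n / real n) \<longlonglongrightarrow> l"
    by (rule quasi_additive_limit[OF lim bound])
  then show ?thesis
    unfolding b_def by (rule convergentI)
qed

text \<open>The density of \<open>q\<close> against \<open>p\<close> on words is
  \<open>1 + t * M + G + F\<close>, where \<open>M\<close> sums \<open>\<nu>\<close>,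
  \<open>G\<close> sums the first-order remainder \<open>h - t * \<nu>\<close>, and \<open>F\<close>
  collects degrees at least 2. Both \<open>G\<close> and \<open>F\<close> are centred, so each costs
  \<open>sqrt n\<close> times its l2 norm: \<open>sqrt (n * r)\<close> for \<open>G\<close>, at most
  \<open>n * v\<close> for \<open>F\<close>.\<close>

lemma expected_length_perturbation:
  fixes t :: real
  assumes q: "\<And>a. a \<in> S \<Longrightarrow> q a = p a * (1 + h a)"
    and h: "(\<Sum>a\<in>S. p a * h a) = 0" and \<nu>: "(\<Sum>a\<in>S. p a * \<nu> a) = 0"
  defines "v \<equiv> \<Sum>a\<in>S. p a * (h a)\<^sup>2" and "r \<equiv> \<Sum>a\<in>S. p a * (h a - t * \<nu> a)\<^sup>2"
  assumes nv: "real n * v \<le> 1"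
  shows "\<bar>word_expectation S q n len - E n len - t * E n (\<lambda>w. len w * (\<Sum>a\<leftarrow>w. \<nu> a))\<bar>
    \<le> (2 * C + 2 * D) * (real n * sqrt (real n) * v + real n * sqrt r)"
proof -
  define L where "L w = (\<Prod>a\<leftarrow>w. 1 + h a)" for w :: "'a list"
  define F where "F w = L w - 1 - (\<Sum>a\<leftarrow>w. h a)" for w :: "'a list"
  define G where "G w = (\<Sum>a\<leftarrow>w. h a - t * \<nu> a)" for w :: "'a list"
  have CD: "0 \<le> 2 * C + 2 * D" using C_nonneg D_nonneg by simp
  have v0: "0 \<le> v" unfolding v_def by (intro sum_nonneg mult_nonneg_nonneg p_nonneg) auto
  have G_eq: "G w = (\<Sum>a\<leftarrow>w. h a) - t * (\<Sum>a\<leftarrow>w. \<nu> a)" for w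
    by (simp add: G_def sum_list_subtractf sum_list_const_mult)
  have "word_expectation S q n len = E n (\<lambda>w. L w * len w)"
    unfolding L_def by (rule word_expectation_change_weights[OF q])
  also have "\<dots> = E n (\<lambda>w. len w + len w * F w + len w * G w + t * (len w * (\<Sum>a\<leftarrow>w. \<nu> a)))"
    by (simp add: F_def G_eq algebra_simps)
  also have "\<dots> = E n len + E n (\<lambda>w. len w * F w) + E n (\<lambda>w. len w * G w) + t * E n (\<lambda>w. len w * (\<Sum>a\<leftarrow>w. \<nu> a))"
    unfolding word_expectation_add word_expectation_cmult ..
  finally have eq: "word_expectation S q n len - E n len - t * E n (\<lambda>w. len w * (\<Sum>a\<leftarrow>w. \<nu> a)) =
      E n (\<lambda>w. len w * F w) + E n (\<lambda>w. len w * G w)" by simp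
  have "\<bar>E n (\<lambda>w. len w * F w)\<bar> \<le> (2 * C + 2 * D) * sqrt (real n) * (real n * v)"
  proof -
    have "E n (\<lambda>w. (F w)\<^sup>2) \<le> (real n * v)\<^sup>2"
      unfolding F_def L_def E_density_linearization(2)[OF h] v_def[symmetric]
      by (rule power_minus_linear_bound[OF v0 nv])
    then have "sqrt (E n (\<lambda>w. (F w)\<^sup>2)) \<le> real n * v"
      using v0 by (intro real_le_lsqrt) auto
    then have "(2 * C + 2 * D) * sqrt (real n) * sqrt (E n (\<lambda>w. (F w)\<^sup>2)) \<le> (2 * C + 2 * D) * sqrt (real n) * (real n * v)"
      using CD by (intro mult_left_mono) auto
    moreover have "E n F = 0"
      unfolding F_def L_def by (rule E_density_linearization(1)[OF h])
    ultimately show ?thesis using E_length_covariance[of n F] by simp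
  qed
  moreover have "\<bar>E n (\<lambda>w. len w * G w)\<bar> \<le> (2 * C + 2 * D) * (real n * sqrt r)"
  proof -
    have 0: "(\<Sum>a\<in>S. p a * (h a - t * \<nu> a)) = 0"
    proof -
      have "(\<Sum>a\<in>S. p a * (h a - t * \<nu> a)) = (\<Sum>a\<in>S. p a * h a) - t * (\<Sum>a\<in>S. p a * \<nu> a)"
        unfolding sum_distrib_left sum_subtractf[symmetric] by (intro sum.cong) (simp_all add: algebra_simps)
      then show ?thesis by (simp add: h \<nu>)
    qed
    have "E n G = 0" unfolding G_def by (rule E_additive_mean_zero[OF 0])
    then have "\<bar>E n (\<lambda>w. len w * G w)\<bar> \<le> (2 * C + 2 * D) * sqrt (real n) * sqrt (real n * r)"
      using E_length_covariance[of n G] unfolding G_def E_additive_square[OF 0] r_def by simp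
    then show ?thesis by (simp add: real_sqrt_mult mult.assoc) (simp flip: mult.assoc)
  qed
  ultimately show ?thesis unfolding eq
    by (simp add: algebra_simps)
qed

end

section \<open>The walk measure and the convolution powers\<close>

lemma symmetric_weights_pmf:
  assumes "finite S" "symmetric_set S" "\<mu> \<in> sym_pmfs S"
  shows "symmetric_weights S (pmf \<mu>)"
proof
  show "sum (pmf \<mu>) S = 1"
    using assms sum_pmf_eq_1[of S \<mu>] by (simp add: sym_pmfs_def)
qed (use assms in \<open>auto simp: symmetric_set_def sym_pmfs_def\<close>)

lemma expectation_convolution_power:
  fixes S :: "'a::group_add set" and f :: "'a \<Rightarrow> real"
  assumes S: "finite S" "set_pmf \<mu> = S"
  shows "finite (set_pmf (convolution_power \<mu> n)) \<and>
    measure_pmf.expectation (convolution_power \<mu> n) f =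
    word_expectation S (pmf \<mu>) n (\<lambda>w. f (sum_list w))"
proof (induction n arbitrary: f)
  case (Suc n)
  define A where "A = set_pmf (convolution_power \<mu> n)"
  have A: "finite A" using Suc by (simp add: A_def)
  have conv: "convolution_power \<mu> (Suc n) = convolution_power \<mu> n \<bind> (\<lambda>x. map_pmf ((+) x) \<mu>)"
    by (simp add: convolution_pmf_def pair_pmf_def map_bind_pmf bind_return_pmf map_pmf_def bind_assoc_pmf)
  have \<mu>: "measure_pmf.expectation \<mu> g = (\<Sum>a\<in>S. pmf \<mu> a * g a)" for g :: "'a \<Rightarrow> real"
    using integral_measure_pmf_real[of S \<mu> g] S by (simp add: mult.commute)
  have "measure_pmf.expectation (convolution_power \<mu> (Suc n)) f =
      (\<Sum>x\<in>A. pmf (convolution_power \<mu> n) x * (\<Sum>a\<in>S. pmf \<mu> a * f (x + a)))"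
    unfolding conv by (subst pmf_expectation_bind[of A]) (use A S in \<open>auto simp: A_def \<mu>\<close>)
  also have "\<dots> = measure_pmf.expectation (convolution_power \<mu> n) (\<lambda>x. \<Sum>a\<in>S. pmf \<mu> a * f (x + a))"
    using integral_measure_pmf_real[OF A] by (simp add: A_def mult.commute)
  also have "\<dots> = word_expectation S (pmf \<mu>) n (\<lambda>w. \<Sum>a\<in>S. pmf \<mu> a * f (sum_list w + a))"
    using Suc by blast
  also have "\<dots> = word_expectation S (pmf \<mu>) (Suc n) (\<lambda>w. f (sum_list w))"
    unfolding word_expectation_Suc_snoc by simp
  finally have "measure_pmf.expectation (convolution_power \<mu> (Suc n)) f =
      word_expectation S (pmf \<mu>) (Suc n) (\<lambda>w. f (sum_list w))" .
  moreover have "finite (set_pmf (convolution_power \<mu> (Suc n)))"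
    unfolding conv using A S by (auto simp: A_def)
  ultimately show ?case by blast
qed simp

lemma infsum_convolution_power:
  fixes S :: "'a::group_add set" and f :: "'a \<Rightarrow> real"
  assumes "finite S" "set_pmf \<mu> = S"
  shows "(\<Sum>\<^sub>\<infinity>x. f x * pmf (convolution_power \<mu> n) x) = word_expectation S (pmf \<mu>) n (\<lambda>w. f (sum_list w))"
proof -
  define A where "A = set_pmf (convolution_power \<mu> n)"
  have A: "finite A" using expectation_convolution_power[OF assms] by (simp add: A_def)
  have "(\<Sum>\<^sub>\<infinity>x. f x * pmf (convolution_power \<mu> n) x) = infsum (\<lambda>x. f x * pmf (convolution_power \<mu> n) x) A"
    by (rule infsum_cong_neutral) (auto simp: A_def set_pmf_iff)
  also have "\<dots> = measure_pmf.expectation (convolution_power \<mu> n) f"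
    using integral_measure_pmf_real[OF A, of "convolution_power \<mu> n" f] A by (simp add: A_def)
  finally show ?thesis using expectation_convolution_power[OF assms] by metis
qed

lemma word_expectation_point:
  fixes u :: "'a list"
  assumes "finite S" "set u \<subseteq> S"
  shows "word_expectation S p (length u) (\<lambda>w. of_bool (w = u)) = (\<Prod>i<length u. p (u ! i))"
  using assms(2)
proof (induction u)
  case (Cons b u)
  have "word_expectation S p (length (b # u)) (\<lambda>w. of_bool (w = b # u)) =
      (\<Sum>a\<in>S. of_bool (a = b) * (p a * word_expectation S p (length u) (\<lambda>w. of_bool (w = u))))"
    by (simp add: of_bool_conj word_expectation_cmult mult_ac)
  also have "\<dots> = p b * (\<Prod>i<length u. p (u ! i))"
    using Cons assms(1) by (simp add: of_bool_def if_distrib[of "\<lambda>x. x * _"] cong: if_cong)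
  also have "\<dots> = (\<Prod>i<length (b # u). p ((b # u) ! i))"
    unfolding length_Cons prod.lessThan_Suc_shift by simp
  finally show ?case .
qed simp

lemma word_expectation_eq_sum:
  assumes S: "finite S"
  shows "word_expectation S p n F = (\<Sum>u | set u \<subseteq> S \<and> length u = n. F u * (\<Prod>i<n. p (u ! i)))"
proof -
  define W where "W = {u. set u \<subseteq> S \<and> length u = n}"
  have W: "finite W" unfolding W_def by (rule finite_lists_length_eq[OF S])
  have "F w = (\<Sum>u\<in>W. F u * of_bool (w = u))" if "w \<in> W" for w
    using W that by (simp add: of_bool_def if_distrib[of "\<lambda>x. _ * x"] cong: if_cong)
  then have "word_expectation S p n F = word_expectation S p n (\<lambda>w. \<Sum>u\<in>W. F u * of_bool (w = u))"
    by (intro word_expectation_cong) (simp add: W_def)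
  also have "\<dots> = (\<Sum>u\<in>W. F u * word_expectation S p n (\<lambda>w. of_bool (w = u)))"
    unfolding word_expectation_sum word_expectation_cmult ..
  also have "\<dots> = (\<Sum>u\<in>W. F u * (\<Prod>i<n. p (u ! i)))"
    by (intro sum.cong) (auto simp: W_def word_expectation_point[OF S])
  finally show ?thesis unfolding W_def .
qed

text \<open>Almost surely all increments lie in \<open>S\<close>, so the integrand is a finite
  combination of indicators of cylinders, whose measures are products of weights.\<close>

lemma integral_walk_measure:
  fixes \<mu> :: "'a pmf" and F :: "'a list \<Rightarrow> real"
  assumes S: "finite S" "set_pmf \<mu> = S" and "countable (UNIV :: 'a set)"
  shows "(LINT \<omega>|walk_measure \<mu>. F (map \<omega> [0..<n])) = word_expectation S (pmf \<mu>) n F"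
proof -
  interpret product_prob_space "\<lambda>_::nat. measure_pmf \<mu>" UNIV
    by unfold_locales
  have space: "space (walk_measure \<mu>) = UNIV"
    by (simp add: walk_measure_def space_PiM)
  define W where "W = {u. set u \<subseteq> S \<and> length u = n}"
  have W: "finite W" unfolding W_def by (rule finite_lists_length_eq[OF S(1)])
  have cyl: "{\<omega>. map \<omega> [0..<n] = u} = prod_emb UNIV (\<lambda>_. measure_pmf \<mu>) {..<n} (\<Pi>\<^sub>E i\<in>{..<n}. {u ! i})"
    if "length u = n" for u :: "'a list"
  proof -
    have "{\<omega>. map \<omega> [0..<n] = u} = {\<omega>\<in>space (walk_measure \<mu>). \<forall>i\<in>{..<n}. \<omega> i \<in> {u ! i}}"
      using that by (auto simp: space list_eq_iff_nth_eq)
    also have "\<dots> = prod_emb UNIV (\<lambda>_. measure_pmf \<mu>) {..<n} (\<Pi>\<^sub>E i\<in>{..<n}. {u ! i})"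
      by (simp add: prod_emb_def walk_measure_def space_PiM restrict_PiE_iff vimage_def Pi_def Ball_def)
    finally show ?thesis .
  qed
  have cyl_sets: "{\<omega>. map \<omega> [0..<n] = u} \<in> sets (walk_measure \<mu>)" for u :: "'a list"
  proof (cases "length u = n")
    case True
    show ?thesis
      unfolding cyl[OF True] walk_measure_def by (rule sets_PiM_I) auto
  next
    case False
    then have "{\<omega>. map \<omega> [0..<n] = u} = {}" by auto
    then show ?thesis by simp
  qed
  have cyl_measure: "measure (walk_measure \<mu>) {\<omega>. map \<omega> [0..<n] = u} = (\<Prod>i<n. pmf \<mu> (u ! i))"
    if "length u = n" for u :: "'a list"
    unfolding cyl[OF that] walk_measure_def by (simp add: measure_PiM_emb measure_pmf_single)
  \<comment> \<open>With countably many words, measurability into the discrete space reduces to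
    preimages of single words, which are cylinders.\<close>
  have "(\<lambda>\<omega>. map \<omega> [0..<n]) \<in> measurable (walk_measure \<mu>) (count_space UNIV)"
  proof (subst measurable_count_space_eq_countable)
    have "UNIV = lists (UNIV :: 'a set)" by auto
    then show "countable (UNIV :: 'a list set)" using countable_lists[OF assms(3)] by simp
    show "(\<lambda>\<omega>. map \<omega> [0..<n]) \<in> space (walk_measure \<mu>) \<rightarrow> UNIV \<and>
        (\<forall>u\<in>UNIV. (\<lambda>\<omega>. map \<omega> [0..<n]) -` {u} \<inter> space (walk_measure \<mu>) \<in> sets (walk_measure \<mu>))"
      using cyl_sets by (simp add: space vimage_def)
  qed
  then have F_meas: "(\<lambda>\<omega>. F (map \<omega> [0..<n])) \<in> borel_measurable (walk_measure \<mu>)"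
    by (rule measurable_compose) simp
  have ind: "integrable (walk_measure \<mu>) (indicat_real {\<omega>. map \<omega> [0..<n] = u})" for u
    using cyl_sets[of u] unfolding walk_measure_def
    by (intro integrable_real_indicator) (simp_all add: P.emeasure_eq_measure)
  have "AE \<omega> in walk_measure \<mu>. \<omega> i \<in> S" for i
    unfolding walk_measure_def by (rule AE_component) (auto simp: AE_measure_pmf_iff S)
  then have "AE \<omega> in walk_measure \<mu>. \<forall>i. \<omega> i \<in> S"
    by (simp add: AE_all_countable)
  then have "AE \<omega> in walk_measure \<mu>. F (map \<omega> [0..<n]) =
      (\<Sum>u\<in>W. F u * indicat_real {\<omega>. map \<omega> [0..<n] = u} \<omega>)"
  proof eventually_elim
    case (elim \<omega>)
    then have "map \<omega> [0..<n] \<in> W" by (auto simp: W_def)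
    then show ?case
      using W by (simp add: indicator_def if_distrib[of "\<lambda>x. _ * x"] of_bool_def cong: if_cong)
  qed
  then have "(LINT \<omega>|walk_measure \<mu>. F (map \<omega> [0..<n])) =
      (LINT \<omega>|walk_measure \<mu>. (\<Sum>u\<in>W. F u * indicat_real {\<omega>. map \<omega> [0..<n] = u} \<omega>))"
    using cyl_sets by (intro integral_cong_AE F_meas) auto
  also have "\<dots> = (\<Sum>u\<in>W. F u * measure (walk_measure \<mu>) {\<omega>. map \<omega> [0..<n] = u})"
    using ind cyl_sets by (subst Bochner_Integration.integral_sum) (auto simp: space)
  also have "\<dots> = word_expectation S (pmf \<mu>) n F"
    unfolding word_expectation_eq_sum[OF S(1)] by (intro sum.cong) (auto simp: W_def cyl_measure)
  finally show ?thesis .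
qed

lemma walk_eq_sum_list: "walk n \<omega> = sum_list (map \<omega> [0..<n])"
  by (induction n) simp_all

lemma walk_martingale_eq_sum_list: "walk_martingale \<nu> n \<omega> = (\<Sum>a\<leftarrow>map \<omega> [0..<n]. \<nu> a)"
proof -
  have "walk_martingale \<nu> n \<omega> = (\<Sum>j=1..n. \<nu> (\<omega> (j - 1)))"
    unfolding walk_martingale_def by (intro sum.cong) (auto simp: increment_eq)
  also have "\<dots> = (\<Sum>a\<leftarrow>map \<omega> [0..<n]. \<nu> a)"
    by (induction n) simp_all
  finally show ?thesis .
qed

section \<open>Countability and growth of the group, and the constants of the metric\<close>

lemma generates_imp_countable:
  fixes S :: "'a::group_add set"
  assumes "finite S" "generates S"
  shows "countable (UNIV :: 'a set)"
proof -
  have "x \<in> sum_list ` lists (S \<union> uminus ` S)" for x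
    using assms(2) unfolding generates_def lists_eq_set by (metis (mono_tags, lifting) imageI mem_Collect_eq)
  then have "UNIV = sum_list ` lists (S \<union> uminus ` S)" by blast
  moreover have "countable (sum_list ` lists (S \<union> uminus ` S))"
    using assms(1) by (simp add: countable_finite)
  ultimately show ?thesis by simp
qed

text \<open>Padding a shortest word with the letter \<open>0\<close> represents the ball by words of
  length exactly \<open>n\<close>.\<close>

lemma card_word_length_le:
  fixes T :: "'a::group_add set"
  assumes T: "finite T" "generates T"
  shows "finite {y. word_length T y \<le> n}"
    and "card {y. word_length T y \<le> n} \<le> card (insert 0 (T \<union> uminus ` T)) ^ n"
proof -
  define U where "U = insert 0 (T \<union> uminus ` T)"
  have U: "finite U" using T by (simp add: U_def)
  have sub: "{y. word_length T y \<le> n} \<subseteq> sum_list ` {xs. set xs \<subseteq> U \<and> length xs = n}"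
  proof
    fix y assume y: "y \<in> {y. word_length T y \<le> n}"
    obtain ys where "set ys \<subseteq> T \<union> uminus ` T" "sum_list ys = y"
      using T(2) unfolding generates_def by blast
    then have "\<exists>k xs. length xs = k \<and> set xs \<subseteq> T \<union> uminus ` T \<and> sum_list xs = y" by blast
    from LeastI_ex[OF this]
    obtain xs where xs: "length xs = word_length T y" "set xs \<subseteq> T \<union> uminus ` T" "sum_list xs = y"
      unfolding word_length_def by blast
    have "set (xs @ replicate (n - length xs) 0) \<subseteq> U" "length (xs @ replicate (n - length xs) 0) = n"
      using xs y by (auto simp: U_def)
    moreover have "sum_list (replicate m (0::'a)) = 0" for m
      by (induction m) simp_all
    then have "sum_list (xs @ replicate (n - length xs) 0) = y"
      using xs by simp
    ultimately show "y \<in> sum_list ` {xs. set xs \<subseteq> U \<and> length xs = n}"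
      by (intro image_eqI[of _ _ "xs @ replicate (n - length xs) 0"]) auto
  qed
  then show "finite {y. word_length T y \<le> n}"
    by (rule finite_surj[OF finite_lists_length_eq[OF U]])
  have "card {y. word_length T y \<le> n} \<le> card {xs. set xs \<subseteq> U \<and> length xs = n}"
    by (rule surj_card_le[OF finite_lists_length_eq[OF U] sub])
  then show "card {y. word_length T y \<le> n} \<le> card (insert 0 (T \<union> uminus ` T)) ^ n"
    by (simp only: card_lists_length_eq[OF U] U_def[symmetric])
qed

lemma hyp_metrics_imp_left_invariant_hyperbolic_metric:
  fixes d :: "'a::group_add \<Rightarrow> 'a \<Rightarrow> real"
  assumes d: "d \<in> hyp_metrics"
  obtains \<tau> B where "left_invariant_hyperbolic_metric d \<tau> B"
proof -
  have metric: "Metric_space UNIV d" and inv: "\<And>g x y. d (g + x) (g + y) = d x y"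
    and fin: "\<And>x r. finite {y. d x y \<le> r}"
    using d by (auto simp: hyp_metrics_def)
  interpret Metric_space UNIV d by (rule metric)
  obtain T where T: "finite T" "generates T" "quasi_isometric_via_id d (word_metric T)"
    using d by (auto simp: hyp_metrics_def)
  obtain A b where A: "A \<ge> 1" and b: "b \<ge> 0" and qi: "\<And>x y. word_metric T x y / A - b \<le> d x y"
    using T(3) unfolding quasi_isometric_via_id_def by blast
  obtain \<tau>0 where \<tau>0: "\<And>x y z w. gromov_product d w x y \<ge> min (gromov_product d w x z) (gromov_product d w z y) - \<tau>0"
    using d by (auto simp: hyp_metrics_def hyperbolic_metric_def)
  define \<tau> where "\<tau> = max \<tau>0 0"
  define k where "k = card (insert 0 (T \<union> uminus ` T))"
  have k: "k \<ge> 1" using T by (simp add: k_def Suc_le_eq card_gt_0_iff)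
  \<comment> \<open>A ball of radius \<open>R\<close> has word lengths at most
    \<open>A * (R + b)\<close>, and \<open>R + b \<le> (1 + b) * (R + 1)\<close>.\<close>
  define B where "B = ln (real k) * A * (1 + b)"
  have "left_invariant_hyperbolic_metric d \<tau> B"
  proof
    show "d x z \<le> d x y + d y z" for x y z by (rule triangle) auto
    show "d x y = d y x" for x y by (rule commute)
    show "d p q + d c e \<le> max (d p c + d q e) (d p e + d q c) + 2 * \<tau>" for p q c e
    proof -
      have "min (gromov_product d e p c) (gromov_product d e c q) - \<tau> \<le> gromov_product d e p q"
        using \<tau>0[of e p c q] by (simp add: \<tau>_def)
      then show ?thesis
        unfolding gromov_product_def commute[of q c]
        by (auto simp: min_def max_def field_simps split: if_splits)
    qed
    show "0 \<le> B" using k A b by (simp add: B_def)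
    show "real (card {y. d 0 y \<le> R}) \<le> exp (B * (R + 1))" if R: "0 \<le> R" for R
    proof -
      define n where "n = nat \<lfloor>A * (R + b)\<rfloor>"
      have "{y. d 0 y \<le> R} \<subseteq> {y. word_length T y \<le> n}"
      proof
        fix y assume "y \<in> {y. d 0 y \<le> R}"
        then have "word_metric T 0 y / A \<le> R + b" using qi[of 0 y] by simp
        then have "real (word_length T y) \<le> A * (R + b)"
          using A by (simp add: word_metric_def divide_le_eq mult.commute)
        then show "y \<in> {y. word_length T y \<le> n}"
          by (simp add: n_def le_nat_floor)
      qed
      then have "card {y. d 0 y \<le> R} \<le> k ^ n"
        using card_word_length_le[OF T(1,2), of n] unfolding k_def by (meson card_mono order_trans)
      then have "real (card {y. d 0 y \<le> R}) \<le> real k ^ n"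
        by (metis of_nat_le_iff of_nat_power)
      also have "\<dots> = exp (ln (real k) * real n)"
        using k by (simp add: exp_of_nat2_mult)
      also have "\<dots> \<le> exp (ln (real k) * (A * (1 + b) * (R + 1)))"
      proof -
        have "real n \<le> A * (R + b)"
          using A R b by (simp add: n_def)
        also have "\<dots> \<le> A * ((1 + b) * (R + 1))"
          using A R b by (intro mult_left_mono) (auto simp: algebra_simps)
        finally show ?thesis
          using k by (simp add: mult_left_mono mult.assoc)
      qed
      finally show ?thesis by (simp add: B_def mult_ac)
    qed
  qed (use fin inv in \<open>auto simp: \<tau>_def\<close>)
  then show thesis by (rule that)
qed

section \<open>The rate of escape and the covariance as limits of word sums\<close>

context escaping_walk
begin

lemma rate_of_escape_bound:
  assumes "set_pmf \<mu> = S" "p = pmf \<mu>" "0 < n"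
  shows "\<bar>E n len / real n - rate_of_escape \<mu> d\<bar> \<le> 2 * C / real n"
proof -
  obtain m where m: "(\<lambda>n. E n len / real n) \<longlonglongrightarrow> m"
      "\<And>n. 0 < n \<Longrightarrow> \<bar>E n len / real n - m\<bar> \<le> 2 * C / real n"
    using escape_rate by blast
  have "(1 / real n) * (\<Sum>\<^sub>\<infinity>x. d 0 x * pmf (convolution_power \<mu> n) x) = E n len / real n" for n
    using infsum_convolution_power[OF finite_S assms(1), of "d 0" n] by (simp add: assms(2))
  then have "rate_of_escape \<mu> d = m"
    unfolding rate_of_escape_def by (simp only: limI[OF m(1)])
  then show ?thesis using m(2)[OF assms(3)] by simp
qed

lemma asymptotic_covariance_LIMSEQ:
  assumes "set_pmf \<mu> = S" "p = pmf \<mu>" "countable (UNIV :: 'a set)"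
    and \<nu>: "(\<Sum>a\<in>S. p a * \<nu> a) = 0"
  shows "(\<lambda>n. E n (\<lambda>w. len w * (\<Sum>a\<leftarrow>w. \<nu> a)) / real n) \<longlonglongrightarrow> asymptotic_covariance \<nu> \<mu> d"
proof -
  have "(1 / real n) * (LINT \<omega>|walk_measure \<mu>. d 0 (walk n \<omega>) * walk_martingale \<nu> n \<omega>) =
      E n (\<lambda>w. len w * (\<Sum>a\<leftarrow>w. \<nu> a)) / real n" for n
    using integral_walk_measure[OF finite_S assms(1,3), of "\<lambda>w. len w * (\<Sum>a\<leftarrow>w. \<nu> a)" n]
    by (simp add: walk_eq_sum_list walk_martingale_eq_sum_list assms(2))
  then have "asymptotic_covariance \<nu> \<mu> d = lim (\<lambda>n. E n (\<lambda>w. len w * (\<Sum>a\<leftarrow>w. \<nu> a)) / real n)"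
    unfolding asymptotic_covariance_def by (simp only:)
  then show ?thesis
    using covariance_convergent[OF \<nu>] by (simp add: convergent_LIMSEQ_iff)
qed

end

text \<open>The order of quantifiers is the point: \<open>C\<close> and \<open>D\<close> are chosen
  from \<open>S\<close>, \<open>d\<close> and \<open>c\<close> before \<open>p\<close>.\<close>

lemma nonamenable_escaping_walk:
  fixes S :: "'a::group_add set"
  assumes "left_invariant_hyperbolic_metric d \<tau> B"
    and "\<not> amenable TYPE('a)" "finite S" "generates S" "S \<noteq> {}" "c > 0"
  obtains C D where "\<And>p. symmetric_weights S p \<Longrightarrow> (\<And>s. s \<in> S \<Longrightarrow> c \<le> p s) \<Longrightarrow> escaping_walk S p d \<tau> B C D"
proof -
  interpret left_invariant_hyperbolic_metric d \<tau> B by fact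
  obtain \<rho> where \<rho>: "0 < \<rho>" "\<rho> < 1"
    "\<And>p n z. symmetric_weights S p \<Longrightarrow> (\<And>s. s \<in> S \<Longrightarrow> c \<le> p s) \<Longrightarrow>
       word_expectation S p n (\<lambda>w. of_bool (sum_list w = z)) \<le> \<rho> ^ n"
    using nonamenable_return_probability[OF assms(2-6)] by blast
  define D where "D = (\<Sum>s\<in>S. d 0 s)"
  have D: "d 0 s \<le> D" if "s \<in> S" for s
    unfolding D_def using assms(3) that by (intro member_le_sum nonneg)
  have D0: "0 \<le> D" unfolding D_def by (intro sum_nonneg nonneg)
  obtain C where C: "0 \<le> C" "\<And>p n x. symmetric_weights S p \<Longrightarrow>
       (\<And>n z. word_expectation S p n (\<lambda>w. of_bool (sum_list w = z)) \<le> \<rho> ^ n) \<Longrightarrow>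
       word_expectation S p n (\<lambda>w. gp x (sum_list w)) \<le> C"
    using expected_gromov_product_bounded[OF \<rho>(1,2) D D0] by blast
  have "escaping_walk S p d \<tau> B C D" if "symmetric_weights S p" "\<And>s. s \<in> S \<Longrightarrow> c \<le> p s" for p
    by (intro escaping_walk.intro escaping_walk_axioms.intro that(1) assms(1) C(2) \<rho>(3) D D0 that)
  then show thesis by (rule that)
qed

theorem theorem2p1:
  fixes S :: "'a::group_add set"
    and \<mu> :: "real \<Rightarrow> 'a pmf"
    and \<nu> :: "'a \<Rightarrow> real"
    and d :: "'a \<Rightarrow> 'a \<Rightarrow> real"
  assumes "infinite (UNIV :: 'a set)"
    and "hyperbolic_group TYPE('a)"
    and "nonelementary TYPE('a)"
    and "finite S" and "symmetric_set S" and "generates S"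
    and "\<And>t. t \<in> {-1..1} \<Longrightarrow> \<mu> t \<in> sym_pmfs S"
    and "\<And>a. a \<in> S \<Longrightarrow> ((\<lambda>t. ln (pmf (\<mu> t) a)) has_real_derivative \<nu> a) (at 0)"
    and "d \<in> hyp_metrics"
    and "assumption_BA d"
  shows "((\<lambda>t. rate_of_escape (\<mu> t) d) has_real_derivative
           asymptotic_covariance \<nu> (\<mu> 0) d) (at 0)"
proof -
  define p where "p t = pmf (\<mu> t)" for t
  have finS: "finite S" by fact
  have S_support: "set_pmf (\<mu> t) = S" if "t \<in> {-1..1}" for t
    using assms(7)[OF that] by (simp add: sym_pmfs_def)
  have S_ne: "S \<noteq> {}"
    using S_support[of 0] set_pmf_not_empty[of "\<mu> 0"] by simp
  have weights: "symmetric_weights S (p t)" if "t \<in> {-1..1}" for t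
    unfolding p_def by (rule symmetric_weights_pmf[OF assms(4,5) assms(7)[OF that]])
  have p_pos: "0 < p t a" if "t \<in> {-1..1}" "a \<in> S" for t a
    using S_support[OF that(1)] that(2) by (simp add: p_def pmf_positive_iff)
  have ev_unit: "\<forall>\<^sub>F t in nhds 0. t \<in> {-1..(1::real)}"
    by (rule eventually_nhds_in_nhd) (simp add: interior_atLeastAtMost_real)
  have p_deriv: "((\<lambda>t. p t a) has_real_derivative p 0 a * \<nu> a) (at 0)" if a: "a \<in> S" for a
  proof -
    have "((\<lambda>t. exp (ln (p t a))) has_real_derivative exp (ln (p 0 a)) * \<nu> a) (at 0)"
      using assms(8)[OF a] unfolding p_def by (rule DERIV_fun_exp)
    moreover have "\<forall>\<^sub>F t in nhds 0. exp (ln (p t a)) = p t a"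
      using ev_unit by eventually_elim (simp add: p_pos a)
    ultimately show ?thesis
      using p_pos[of 0 a] a by (simp cong: DERIV_cong_ev)
  qed
  \<comment> \<open>The one-step density of parameter \<open>t\<close> against parameter
    \<open>0\<close> is \<open>1 + h t\<close>, and \<open>h t a / t\<close> tends to the
    logarithmic derivative \<open>\<nu> a\<close>.\<close>
  define h where "h t a = p t a / p 0 a - 1" for t a
  have p_h: "p t a = p 0 a * (1 + h t a)" if "a \<in> S" for t a
    using p_pos[of 0 a] that by (simp add: h_def)
  have h_lim: "((\<lambda>t. h t a / t) \<longlongrightarrow> \<nu> a) (at 0)" if a: "a \<in> S" for a
  proof -
    have "((\<lambda>t. (p t a - p 0 a) / (t - 0) / p 0 a) \<longlongrightarrow> p 0 a * \<nu> a / p 0 a) (at 0)"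
      using p_deriv[OF a] p_pos[of 0 a] a unfolding has_field_derivative_iff by (intro tendsto_divide) auto
    moreover have "(p t a - p 0 a) / (t - 0) / p 0 a = h t a / t" for t
      using p_pos[of 0 a] a by (simp add: h_def field_simps)
    ultimately show ?thesis using p_pos[of 0 a] a by simp
  qed
  have ev_at: "\<forall>\<^sub>F t in at 0. t \<in> {-1..(1::real)} \<and> t \<noteq> 0"
    using ev_unit unfolding eventually_at_filter by eventually_elim simp
  have h_mean: "(\<Sum>a\<in>S. p 0 a * h t a) = 0" if "t \<in> {-1..1}" for t
  proof -
    have "(\<Sum>a\<in>S. p 0 a * h t a) = (\<Sum>a\<in>S. p t a - p 0 a)"
      by (intro sum.cong) (simp_all add: p_h[of _ t] algebra_simps)
    then show ?thesis
      using symmetric_weights.sum_p[OF weights] that by (simp add: sum_subtractf)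
  qed
  \<comment> \<open>Both parameters have total mass 1, so \<open>h t\<close> is centred, and this
    passes to the limit of \<open>h t / t\<close>.\<close>
  have \<nu>_mean: "(\<Sum>a\<in>S. p 0 a * \<nu> a) = 0"
  proof (rule tendsto_unique)
    show "((\<lambda>t. \<Sum>a\<in>S. p 0 a * (h t a / t)) \<longlongrightarrow> (\<Sum>a\<in>S. p 0 a * \<nu> a)) (at 0)"
      by (intro tendsto_sum tendsto_mult tendsto_const h_lim)
    have "\<forall>\<^sub>F t in at 0. (\<Sum>a\<in>S. p 0 a * (h t a / t)) = 0"
      using ev_at by eventually_elim (simp add: h_mean flip: sum_divide_distrib)
    then show "((\<lambda>t. \<Sum>a\<in>S. p 0 a * (h t a / t)) \<longlongrightarrow> 0) (at 0)"
      by (rule tendsto_eventually)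
  qed simp
  \<comment> \<open>Half the smallest weight at \<open>0\<close> leaves room for the weights at
    nearby \<open>t\<close>, which converge to those at \<open>0\<close>.\<close>
  define c where "c = Min (p 0 ` S) / 2"
  have Min_le: "c < p 0 a" "0 < c" if "a \<in> S" for a
  proof -
    have "0 < Min (p 0 ` S)" using finS S_ne p_pos[of 0] by (subst Min_gr_iff) auto
    moreover have "Min (p 0 ` S) \<le> p 0 a" using finS that by simp
    ultimately show "c < p 0 a" "0 < c" by (simp_all add: c_def)
  qed
  have c: "0 < c" using S_ne Min_le by blast
  have ev_c: "\<forall>\<^sub>F t in nhds 0. \<forall>a\<in>S. c \<le> p t a"
  proof (rule eventually_ball_finite[OF finS], rule ballI)
    fix a assume a: "a \<in> S"
    have "isCont (\<lambda>t. p t a) 0" by (rule DERIV_isCont[OF p_deriv[OF a]])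
    then have "((\<lambda>t. p t a) \<longlongrightarrow> p 0 a) (nhds 0)"
      using tendsto_at_iff_tendsto_nhds[of "\<lambda>t. p t a" 0] by (simp add: isCont_def)
    from order_tendstoD(1)[OF this Min_le(1)[OF a]]
    show "\<forall>\<^sub>F t in nhds 0. c \<le> p t a" by eventually_elim simp
  qed
  obtain \<tau> B where "left_invariant_hyperbolic_metric d \<tau> B"
    using hyp_metrics_imp_left_invariant_hyperbolic_metric[OF assms(9)] .
  moreover have "\<not> amenable TYPE('a)" using assms(3) by (simp add: nonelementary_def)
  ultimately obtain C D where CD: "\<And>p. symmetric_weights S p \<Longrightarrow> (\<And>s. s \<in> S \<Longrightarrow> c \<le> p s) \<Longrightarrow>
      escaping_walk S p d \<tau> B C D"
    using nonamenable_escaping_walk[OF _ _ finS assms(6) S_ne c] by blast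
  define good where "good t \<longleftrightarrow> t \<in> {-1..1} \<and> (\<forall>a\<in>S. c \<le> p t a)" for t
  have walk: "escaping_walk S (p t) d \<tau> B C D" if "good t" for t
    by (rule CD[OF weights]) (use that in \<open>auto simp: good_def\<close>)
  have ev_good: "\<forall>\<^sub>F t in nhds 0. good t"
    using ev_unit ev_c by eventually_elim (simp add: good_def)
  then have good0: "good 0" by (rule eventually_nhds_x_imp_x)
  note walk0 = walk[OF good0]
  define a where "a t n = word_expectation S (p t) n (\<lambda>w. d 0 (sum_list w))" for t n
  define b where "b n = word_expectation S (p 0) n (\<lambda>w. d 0 (sum_list w) * (\<Sum>a\<leftarrow>w. \<nu> a))" for n
  define l where "l t = rate_of_escape (\<mu> t) d" for t
  define \<sigma> where "\<sigma> = asymptotic_covariance \<nu> (\<mu> 0) d"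
  have l: "\<bar>a t n / real n - l t\<bar> \<le> 2 * C / real n" if "good t" "0 < n" for t n
    unfolding a_def l_def
    by (rule escaping_walk.rate_of_escape_bound[OF walk S_support])
      (use that in \<open>auto simp: good_def p_def\<close>)
  have \<sigma>: "(\<lambda>n. b n / real n) \<longlonglongrightarrow> \<sigma>"
    unfolding b_def \<sigma>_def
    by (rule escaping_walk.asymptotic_covariance_LIMSEQ[OF walk0 S_support _ _ \<nu>_mean])
      (use generates_imp_countable[OF finS assms(6)] in \<open>auto simp: p_def\<close>)
  define K where "K = 2 * C + 2 * D"
  define v where "v t = (\<Sum>a\<in>S. p 0 a * (h t a)\<^sup>2)" for t
  define r where "r t = (\<Sum>a\<in>S. p 0 a * (h t a - t * \<nu> a)\<^sup>2)" for t
  \<comment> \<open>Any \<open>N t\<close> with \<open>N t * \<bar>t\<bar> \<rightarrow> \<infinity>\<close> and \<open>N t * t\<^sup>2 \<rightarrow> 0\<close> would do.\<close>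
  define N where "N t = nat \<lceil>\<bar>t\<bar> powr (- 3 / 2)\<rceil>" for t :: real
  have N: "filterlim N at_top (at 0)" and N1: "((\<lambda>t. 1 / (real (N t) * \<bar>t\<bar>)) \<longlongrightarrow> 0) (at 0)"
    and N2: "((\<lambda>t. sqrt (real (N t)) * \<bar>t\<bar>) \<longlongrightarrow> 0) (at 0)" and N3: "((\<lambda>t. real (N t) * t\<^sup>2) \<longlongrightarrow> 0) (at 0)"
    unfolding N_def by real_asymp+
  have v_lim: "((\<lambda>t. v t / t\<^sup>2) \<longlongrightarrow> (\<Sum>a\<in>S. p 0 a * (\<nu> a)\<^sup>2)) (at 0)"
  proof -
    have "((\<lambda>t. \<Sum>a\<in>S. p 0 a * (h t a / t)\<^sup>2) \<longlongrightarrow> (\<Sum>a\<in>S. p 0 a * (\<nu> a)\<^sup>2)) (at 0)"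
      by (intro tendsto_intros h_lim)
    then show ?thesis by (simp add: v_def power_divide sum_divide_distrib)
  qed
  have r_lim: "((\<lambda>t. sqrt (r t) / \<bar>t\<bar>) \<longlongrightarrow> 0) (at 0)"
  proof (rule Lim_transform_eventually)
    have "((\<lambda>t. sqrt (\<Sum>a\<in>S. p 0 a * (h t a / t - \<nu> a)\<^sup>2)) \<longlongrightarrow> sqrt (\<Sum>a\<in>S. p 0 a * (\<nu> a - \<nu> a)\<^sup>2)) (at 0)"
      by (intro tendsto_intros h_lim)
    then show "((\<lambda>t. sqrt (\<Sum>a\<in>S. p 0 a * (h t a / t - \<nu> a)\<^sup>2)) \<longlongrightarrow> 0) (at 0)" by simp
    show "\<forall>\<^sub>F t in at 0. sqrt (\<Sum>a\<in>S. p 0 a * (h t a / t - \<nu> a)\<^sup>2) = sqrt (r t) / \<bar>t\<bar>"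
      using ev_at
    proof eventually_elim
      case (elim t)
      then have "h t a / t - \<nu> a = (h t a - t * \<nu> a) / t" for a
        by (simp add: diff_divide_distrib)
      then have "(\<Sum>a\<in>S. p 0 a * (h t a / t - \<nu> a)\<^sup>2) = r t / t\<^sup>2"
        by (simp add: r_def sum_divide_distrib power_divide)
      then show ?case by (simp add: real_sqrt_divide)
    qed
  qed
  have ev_Nv: "\<forall>\<^sub>F t in at 0. real (N t) * v t \<le> 1"
  proof -
    have "((\<lambda>t. (real (N t) * t\<^sup>2) * (v t / t\<^sup>2)) \<longlongrightarrow> 0) (at 0)"
      using tendsto_mult[OF N3 v_lim] by simp
    then have "\<forall>\<^sub>F t in at 0. (real (N t) * t\<^sup>2) * (v t / t\<^sup>2) < 1"
      by (rule order_tendstoD) simp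
    with ev_at show ?thesis by eventually_elim simp
  qed
  \<comment> \<open>The three errors after division by \<open>t\<close>: two rate approximations of
    \<open>2 * C / N t\<close> each, the expansion of the density, and the distance of the
    covariance at time \<open>N t\<close> from its limit.\<close>
  define g where "g t = 4 * C * (1 / (real (N t) * \<bar>t\<bar>)) +
      K * ((sqrt (real (N t)) * \<bar>t\<bar>) * (v t / t\<^sup>2) + sqrt (r t) / \<bar>t\<bar>) + \<bar>b (N t) / real (N t) - \<sigma>\<bar>" for t
  have g: "(g \<longlongrightarrow> 0) (at 0)"
  proof -
    have "((\<lambda>t. \<bar>b (N t) / real (N t) - \<sigma>\<bar>) \<longlongrightarrow> \<bar>\<sigma> - \<sigma>\<bar>) (at 0)"
      by (intro tendsto_intros filterlim_compose[OF \<sigma> N])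
    from tendsto_add[OF tendsto_add[OF tendsto_mult[OF tendsto_const[of "4 * C"] N1]
      tendsto_mult[OF tendsto_const[of K] tendsto_add[OF tendsto_mult[OF N2 v_lim] r_lim]]] this]
    show ?thesis unfolding g_def by simp
  qed
  have "((\<lambda>t. (l t - l 0) / (t - 0) - \<sigma>) \<longlongrightarrow> 0) (at 0)"
  proof (rule Lim_null_comparison[OF _ g])
    have "\<forall>\<^sub>F t in at 0. good t" using ev_good by (simp add: eventually_nhds_conv_at)
    moreover have "\<forall>\<^sub>F t in at 0. 0 < N t"
      using N[unfolded filterlim_at_top, rule_format, of 1] by (simp add: Suc_le_eq)
    ultimately show "\<forall>\<^sub>F t in at 0. norm ((l t - l 0) / (t - 0) - \<sigma>) \<le> g t"
      using ev_at ev_Nv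
    proof eventually_elim
      case (elim t)
      define n where "n = real (N t)"
      have n: "0 < n" and t: "t \<noteq> 0" using elim by (simp_all add: n_def)
      define x where "x = a t (N t) - a 0 (N t) - t * b (N t)"
      have x: "\<bar>x\<bar> \<le> K * (n * sqrt n * v t + n * sqrt (r t))"
        unfolding x_def n_def a_def b_def K_def v_def r_def
        by (rule escaping_walk.expected_length_perturbation[OF walk0 p_h h_mean \<nu>_mean]) (use elim in \<open>auto simp: v_def good_def\<close>)
      \<comment> \<open>Both rates are replaced by averages at the same time \<open>N t\<close>,
        where the two laws can be compared by their density.\<close>
      have "l t - l 0 - t * \<sigma> = (a 0 (N t) / n - l 0) - (a t (N t) / n - l t) + x / n + t * (b (N t) / n - \<sigma>)"
        using n by (simp add: x_def field_simps)
      also have "\<bar>\<dots>\<bar> \<le> 2 * C / n + 2 * C / n + \<bar>x\<bar> / n + \<bar>t\<bar> * \<bar>b (N t) / n - \<sigma>\<bar>"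
      proof -
        have abs4: "\<bar>u - u' + w + w'\<bar> \<le> \<bar>u\<bar> + \<bar>u'\<bar> + \<bar>w\<bar> + \<bar>w'\<bar>" for u u' w w' :: real
          by linarith
        have "\<bar>a 0 (N t) / n - l 0\<bar> \<le> 2 * C / n" "\<bar>a t (N t) / n - l t\<bar> \<le> 2 * C / n"
          unfolding n_def using elim good0 by (auto intro: l)
        moreover have "\<bar>x / n\<bar> \<le> \<bar>x\<bar> / n" "\<bar>t * (b (N t) / n - \<sigma>)\<bar> \<le> \<bar>t\<bar> * \<bar>b (N t) / n - \<sigma>\<bar>"
          using n by (simp_all add: abs_mult)
        ultimately show ?thesis
          by (intro order_trans[OF abs4] add_mono)
      qed
      also have "\<bar>x\<bar> / n \<le> K * (sqrt n * v t + sqrt (r t))"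
      proof -
        have "\<bar>x\<bar> / n \<le> K * (n * sqrt n * v t + n * sqrt (r t)) / n"
          using x n by (intro divide_right_mono) auto
        also have "\<dots> = K * (sqrt n * v t + sqrt (r t))"
          using n by (simp add: field_simps)
        finally show ?thesis .
      qed
      finally have main: "\<bar>l t - l 0 - t * \<sigma>\<bar> \<le> 4 * C / n + K * (sqrt n * v t + sqrt (r t)) + \<bar>t\<bar> * \<bar>b (N t) / n - \<sigma>\<bar>"
        by simp
      have "(l t - l 0) / (t - 0) - \<sigma> = (l t - l 0 - t * \<sigma>) / t"
        using t by (simp add: diff_divide_distrib)
      then have "norm ((l t - l 0) / (t - 0) - \<sigma>) = \<bar>l t - l 0 - t * \<sigma>\<bar> / \<bar>t\<bar>"
        by (simp only: real_norm_def abs_divide)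
      also have "\<dots> \<le> (4 * C / n + K * (sqrt n * v t + sqrt (r t)) + \<bar>t\<bar> * \<bar>b (N t) / n - \<sigma>\<bar>) / \<bar>t\<bar>"
        by (intro divide_right_mono main) simp
      also have "\<dots> = g t"
      proof -
        have t2: "t\<^sup>2 = \<bar>t\<bar> * \<bar>t\<bar>"
          by (simp add: power2_eq_square)
        have "y * s * (z / (s * s)) = y * z / s" for y s z :: real
          by simp
        then have "sqrt n * \<bar>t\<bar> * (v t / t\<^sup>2) = sqrt n * v t / \<bar>t\<bar>"
          unfolding t2 .
        then show ?thesis
          using t unfolding g_def n_def[symmetric] by (simp add: add_divide_distrib distrib_left)
      qed
      finally show ?case .
    qed
  qed
  then have "((\<lambda>t. (l t - l 0) / (t - 0)) \<longlongrightarrow> \<sigma>) (at 0)"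
    by (rule LIM_zero_cancel)
  then show ?thesis
    unfolding has_field_derivative_iff l_def \<sigma>_def .
qed

end
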